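(* Consider, for positive integers $n$, the inequality $$(\ast)\qquad \mathrm{pp}(n)^2>\mathrm{pp}(n-1)\,\mathrm{pp}(n+1).$$ Then: (i) $(\ast)$ holds for all integers $n$ with $12\leq n\leq 10^5$; (ii) $(\ast)$ holds for all even positive integers $n$, and fails for all odd positive integers $n$ below $12$; (iii) there exists $N$ such that $(\ast)$ holds for all integers $n>N$.
   Context: A plane partition of a non-negative integer $n$ is an array $\pi=(\pi_{ij})_{i,j\geq 1}$ of non-negative integers with $\sum_{i,j\ge 1}\pi_{ij}=n$ that is weakly decreasing along rows and columns. $\mathrm{pp}(n)$ denotes the number of plane partitions of $n$, with $\mathrm{pp}(0)=1$. By MacMahon's theorem, $\sum_{n\ge 0}\mathrm{pp}(n)q^n=\prod_{n\ge1}(1-q^n)^{-n}$; equivalently $n\,\mathrm{pp}(n)=\sum_{k=1}^n\sigma_2(k)\,\mathrm{pp}(n-k)$ for $n\ge 1$, where $\sigma_2(k)=\sum_{d\mid k}d^2$. *)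

theory Defs
  imports Complex_Main
begin

(* Rows and columns are indexed from 0 instead of 1.  Finiteness of the support is
   what convergence of the double sum means for natural numbers; it has to be
   required explicitly because sum over an infinite set is 0. *)
definition plane_partition :: "nat \<Rightarrow> (nat \<Rightarrow> nat \<Rightarrow> nat) \<Rightarrow> bool" where
  "plane_partition n \<pi> \<longleftrightarrow>
     (\<forall>i j. \<pi> i (Suc j) \<le> \<pi> i j) \<and>
     (\<forall>i j. \<pi> (Suc i) j \<le> \<pi> i j) \<and>
     finite {(i, j). \<pi> i j \<noteq> 0} \<and>
     (\<Sum>(i, j) \<in> {(i, j). \<pi> i j \<noteq> 0}. \<pi> i j) = n"

definition pp :: "nat \<Rightarrow> nat" where
  "pp n = card {\<pi>. plane_partition n \<pi>}"

end

theory Submission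
  imports Defs "HOL-Complex_Analysis.Complex_Analysis"
begin

text \<open>
  Toggling diagonals gives a bijection between plane partitions in an \<open>N \<times> N\<close> square and arbitrary
  arrays in which the cells are weighted by hook lengths. Counting these arrays doubly yields
  \<open>n * pp n = (\<Sum>k=1..n. sigma2 k * pp (n - k))\<close>, hence the generating function
  \<open>exp (\<Sum>j. log_coeff j * z ^ j)\<close> with \<open>log_coeff j = sigma2 j / j\<close>.

  For \<open>n \<le> 303\<close> the inequality is decided by computing \<open>pp\<close> from the recurrence. For larger \<open>n\<close>, write
  \<open>P m = pp m * q ^ m\<close> with \<open>q = exp (- s)\<close> at the saddle point, where the tilted mean is \<open>n\<close>; then
  \<open>s \<le> 1 / 5\<close>. By AM-GM it suffices that \<open>P (n - 1) + P (n + 1) < 2 * P n\<close>, and by Cauchy's formula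
  this amounts to positivity of the integral of \<open>exp (- decay) * cos phase * (1 - cos t)\<close> over
  \<open>{0..pi}\<close>. On \<open>t \<le> 1.07 * s\<^sup>2\<close> the integrand is at least a Gaussian times a polynomial, because
  \<open>cos x \<ge> 1 - x\<^sup>2 / 2\<close> and the phase is of third order; the rest is controlled by the explicit
  decay of the part \<open>\<Sum>j. j * z ^ j = z / (1 - z)\<^sup>2\<close> of the logarithm.
\<close>

section \<open>Plane partitions and weighted arrays\<close>

text \<open>The inequality is unchanged by the tilt, since \<open>q ^ (n - 1) * q ^ (n + 1)\<close>
  equals \<open>(q ^ n)\<^sup>2\<close>; so \<open>q\<close> may be chosen freely, and at the saddle
  point the outer two values of \<open>P\<close> are close to each other, which makes AM-GM cheap.
  What has to be shown positive is small: \<open>1 - cos t\<close> vanishes to second order exactly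
  where the integrand is concentrated, so the integral has size \<open>s ^ 6\<close> (width
  \<open>s ^ 2\<close> times height \<open>s ^ 4\<close>), and every error is measured on that
  scale. The obstacle is the phase. For \<open>t = s ^ 2 * y\<close> the available bound on its
  square is about \<open>32 * s ^ 2 * y ^ 6\<close>, which leaves a usable core only for small
  \<open>s\<close>. The choice \<open>s \<le> 1 / 5\<close> suffices, and it fixes the range of the
  computation, because the mean at \<open>s = 1 / 5\<close> is at most
  \<open>29 / 12 * 5 ^ 3 < 303\<close>. On the combinatorial side, the squares in
  \<open>sigma2\<close> come from hook lengths: each length \<open>d \<le> N\<close> occurs
  \<open>d\<close> times in the square of side \<open>N\<close>. A finite square is enough because
  only lengths up to \<open>n\<close> can influence \<open>pp n\<close>.\<close>

text \<open>Cells are indexed from 1, so that row and column 0 can serve as a zero boundary.\<close>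

definition young :: "(nat \<times> nat) set \<Rightarrow> bool" where
  "young Y \<longleftrightarrow> finite Y \<and> (\<forall>i j. (i, j) \<in> Y \<longrightarrow> 0 < i \<and> 0 < j) \<and>
     (\<forall>i j i' j'. (i, j) \<in> Y \<longrightarrow> 0 < i' \<longrightarrow> i' \<le> i \<longrightarrow> 0 < j' \<longrightarrow> j' \<le> j \<longrightarrow> (i', j') \<in> Y)"

definition arr :: "'b set \<Rightarrow> ('b \<Rightarrow> nat) set" where
  "arr Y = {A. \<forall>b. b \<notin> Y \<longrightarrow> A b = 0}"

text \<open>Reverse plane partitions of shape \<open>Y\<close>. For a Young diagram \<open>Y\<close>
  the cells in row or column 0 lie outside \<open>Y\<close> and carry 0, so the comparisons with
  \<open>i - 1\<close> and \<open>j - 1\<close> are correct at the border.\<close>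

definition rpp :: "(nat \<times> nat) set \<Rightarrow> (nat \<times> nat \<Rightarrow> nat) set" where
  "rpp Y = {f \<in> arr Y. \<forall>i j. (i, j) \<in> Y \<longrightarrow> f (i - 1, j) \<le> f (i, j) \<and> f (i, j - 1) \<le> f (i, j)}"

fun diag_sum :: "(nat \<times> nat \<Rightarrow> nat) \<Rightarrow> nat \<Rightarrow> nat \<Rightarrow> nat" where
  "diag_sum f (Suc i) (Suc j) = f (Suc i, Suc j) + diag_sum f i j"
| "diag_sum f _ _ = 0"

lemma diag_sum_0 [simp]: "diag_sum f i 0 = 0"
  by (cases i) auto

definition rect_sum :: "(nat \<times> nat \<Rightarrow> nat) \<Rightarrow> nat \<Rightarrow> nat \<Rightarrow> nat" where
  "rect_sum A i j = (\<Sum>i'\<in>{1..i}. \<Sum>j'\<in>{1..j}. A (i', j'))"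

text \<open>The piecewise-linear toggle, applied at once to the diagonal cells strictly before
  \<open>(Suc p, Suc r)\<close>. The test \<open>i + r = j + p\<close> says
  \<open>i - j = p - r\<close> without truncated subtraction.\<close>

definition toggle :: "nat \<Rightarrow> nat \<Rightarrow> (nat \<times> nat \<Rightarrow> nat) \<Rightarrow> nat \<times> nat \<Rightarrow> nat" where
  "toggle p r f = (\<lambda>(i, j).
     if 0 < i \<and> i \<le> p \<and> 0 < j \<and> i + r = j + p
     then min (f (Suc i, j)) (f (i, Suc j)) + max (f (i - 1, j)) (f (i, j - 1)) - f (i, j)
     else f (i, j))"

lemma toggle_off_diagonal:
  "\<not> (0 < i \<and> i \<le> p \<and> 0 < j \<and> i + r = j + p) \<Longrightarrow> toggle p r f (i, j) = f (i, j)"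
  by (simp only: toggle_def prod.case if_False)

text \<open>The new corner is given by its excess over the larger neighbour, so its admissible
  values correspond to arbitrary naturals \<open>a\<close>.\<close>

definition extend :: "nat \<Rightarrow> nat \<Rightarrow> (nat \<times> nat \<Rightarrow> nat) \<Rightarrow> nat \<Rightarrow> nat \<times> nat \<Rightarrow> nat" where
  "extend p r f a = f((Suc p, Suc r) := a + max (f (p, Suc r)) (f (Suc p, r)))"

lemma diag_sum_cong:
  assumes "\<And>i' j'. i' \<le> i \<Longrightarrow> j' \<le> j \<Longrightarrow> i' + j = j' + i \<Longrightarrow> f (i', j') = g (i', j')"
  shows "diag_sum f i j = diag_sum g i j"
  using assms
proof (induction f i j rule: diag_sum.induct)
  case (1 f i j)
  have "diag_sum f i j = diag_sum g i j"
    by (rule "1.IH") (use "1.prems" in auto)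
  with "1.prems"[of "Suc i" "Suc j"] show ?case by simp
qed auto

lemma rpp_zero:
  assumes "young Y" "f \<in> rpp Y"
  shows "f (0, j) = 0" "f (i, 0) = 0"
  using assms unfolding young_def rpp_def arr_def by blast+

text \<open>Inclusion-exclusion, written additively because subtraction on naturals truncates.
  \<open>diag_sum_toggle_extend\<close> is the same relation for diagonal sums.\<close>

lemma rect_sum_Suc:
  "rect_sum A (Suc i) (Suc j) + rect_sum A i j
     = rect_sum A i (Suc j) + rect_sum A (Suc i) j + A (Suc i, Suc j)"
  by (simp add: rect_sum_def sum.distrib)

section \<open>Adding one corner cell to a shape\<close>

context
  fixes Y :: "(nat \<times> nat) set" and p r :: nat
  assumes young: "young Y" and young': "young (insert (Suc p, Suc r) Y)"
    and new: "(Suc p, Suc r) \<notin> Y"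
begin

abbreviation "Y' \<equiv> insert (Suc p, Suc r) Y"

lemma mem_Y'I: "0 < i \<Longrightarrow> i \<le> Suc p \<Longrightarrow> 0 < j \<Longrightarrow> j \<le> Suc r \<Longrightarrow> (i, j) \<in> Y'"
  using young' unfolding young_def by blast

text \<open>The new cell is an outer corner: a cell of \<open>Y\<close> weakly to its lower right
  would force the new cell into \<open>Y\<close>.\<close>

lemma not_mem_Y'I: "Suc p \<le> i \<Longrightarrow> Suc r \<le> j \<Longrightarrow> (i, j) \<noteq> (Suc p, Suc r) \<Longrightarrow> (i, j) \<notin> Y'"
  using young new unfolding young_def by (metis insertE zero_less_Suc)

lemma rpp_diagonal:
  assumes f: "f \<in> rpp Y'" and ij: "0 < i" "i \<le> p" "0 < j" "i + r = j + p"
  shows "f (i - 1, j) \<le> f (i, j)" "f (i, j - 1) \<le> f (i, j)"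
        "f (i, j) \<le> f (Suc i, j)" "f (i, j) \<le> f (i, Suc j)"
proof -
  have "(i, j) \<in> Y'" "(Suc i, j) \<in> Y'" "(i, Suc j) \<in> Y'"
    by (rule mem_Y'I; use ij in simp)+
  with f have *: "f (i - 1, j) \<le> f (i, j)" "f (i, j - 1) \<le> f (i, j)"
    "f (Suc i - 1, j) \<le> f (Suc i, j)" "f (i, Suc j - 1) \<le> f (i, Suc j)"
    unfolding rpp_def by blast+
  thus "f (i - 1, j) \<le> f (i, j)" "f (i, j - 1) \<le> f (i, j)"
        "f (i, j) \<le> f (Suc i, j)" "f (i, j) \<le> f (i, Suc j)" by simp_all
qed

text \<open>The toggle reflects the interval from \<open>m\<close> to \<open>M\<close>. The old
  value lies in it, so the subtraction does not truncate and the new value lies in it again.\<close>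

lemma toggle_diagonal:
  assumes f: "f \<in> rpp Y'" and ij: "0 < i" "i \<le> p" "0 < j" "i + r = j + p"
  defines "m \<equiv> max (f (i - 1, j)) (f (i, j - 1))" and "M \<equiv> min (f (Suc i, j)) (f (i, Suc j))"
  shows "toggle p r f (i, j) = M + m - f (i, j)" "m \<le> f (i, j)" "f (i, j) \<le> M"
    "m \<le> toggle p r f (i, j)" "toggle p r f (i, j) \<le> M"
proof -
  show eq: "toggle p r f (i, j) = M + m - f (i, j)"
    using ij by (simp add: toggle_def m_def M_def)
  show le: "m \<le> f (i, j)" "f (i, j) \<le> M"
    using rpp_diagonal[OF f ij] by (simp_all add: m_def M_def)
  thus "m \<le> toggle p r f (i, j)" "toggle p r f (i, j) \<le> M"
    unfolding eq by linarith+
qed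

text \<open>Cells of one diagonal are never adjacent, so each inequality compares at most one
  toggled value with an unchanged one, and the interval of \<open>toggle_diagonal\<close> gives
  it.\<close>

lemma toggle_in_rpp:
  assumes f: "f \<in> rpp Y'"
  shows "toggle p r f \<in> rpp Y'"
proof -
  have mono: "f (i - 1, j) \<le> f (i, j)" "f (i, j - 1) \<le> f (i, j)" if "(i, j) \<in> Y'" for i j
    using f that unfolding rpp_def by blast+
  have "toggle p r f (i, j) = 0" if "(i, j) \<notin> Y'" for i j
  proof -
    have "\<not> (0 < i \<and> i \<le> p \<and> 0 < j \<and> i + r = j + p)"
      using that mem_Y'I[of i j] by auto
    with f that show ?thesis by (auto simp: toggle_def rpp_def arr_def)
  qed
  moreover have "toggle p r f (i - 1, j) \<le> toggle p r f (i, j)" if ij: "(i, j) \<in> Y'" for i j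
  proof (cases "0 < i \<and> i \<le> p \<and> 0 < j \<and> i + r = j + p")
    case True
    hence "toggle p r f (i - 1, j) = f (i - 1, j)" unfolding toggle_def by auto
    with True toggle_diagonal(4)[OF f, of i j] show ?thesis by linarith
  next
    case F: False
    hence eq: "toggle p r f (i, j) = f (i, j)" by (rule toggle_off_diagonal)
    show ?thesis
    proof (cases "0 < i - 1 \<and> i - 1 \<le> p \<and> 0 < j \<and> i - 1 + r = j + p")
      case True
      hence "toggle p r f (i - 1, j) \<le> min (f (Suc (i - 1), j)) (f (i - 1, Suc j))"
        by (intro toggle_diagonal(5)[OF f]) auto
      with True show ?thesis by (simp add: eq)
    next
      case False
      hence "toggle p r f (i - 1, j) = f (i - 1, j)" by (rule toggle_off_diagonal)
      with mono[OF ij] show ?thesis by (simp add: eq)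
    qed
  qed
  moreover have "toggle p r f (i, j - 1) \<le> toggle p r f (i, j)" if ij: "(i, j) \<in> Y'" for i j
  proof (cases "0 < i \<and> i \<le> p \<and> 0 < j \<and> i + r = j + p")
    case True
    hence "toggle p r f (i, j - 1) = f (i, j - 1)" unfolding toggle_def by auto
    with True toggle_diagonal(4)[OF f, of i j] show ?thesis by linarith
  next
    case F: False
    hence eq: "toggle p r f (i, j) = f (i, j)" by (rule toggle_off_diagonal)
    show ?thesis
    proof (cases "0 < i \<and> i \<le> p \<and> 0 < j - 1 \<and> i + r = j - 1 + p")
      case True
      hence "toggle p r f (i, j - 1) \<le> min (f (Suc i, j - 1)) (f (i, Suc (j - 1)))"
        by (intro toggle_diagonal(5)[OF f]) auto
      with True show ?thesis by (simp add: eq)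
    next
      case False
      hence "toggle p r f (i, j - 1) = f (i, j - 1)" by (rule toggle_off_diagonal)
      with mono[OF ij] show ?thesis by (simp add: eq)
    qed
  qed
  ultimately show ?thesis
    by (simp only: rpp_def arr_def mem_Collect_eq split_paired_All) blast
qed

text \<open>The neighbours of a diagonal cell lie off the diagonal and keep their values, so the
  second toggle reflects the same interval back.\<close>

lemma toggle_toggle:
  assumes f: "f \<in> rpp Y'"
  shows "toggle p r (toggle p r f) = f"
proof
  fix b :: "nat \<times> nat"
  obtain i j :: nat where b: "b = (i, j)" by force
  show "toggle p r (toggle p r f) b = f b"
  proof (cases "0 < i \<and> i \<le> p \<and> 0 < j \<and> i + r = j + p")
    case True
    hence "toggle p r f (Suc i, j) = f (Suc i, j)" "toggle p r f (i, Suc j) = f (i, Suc j)"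
      "toggle p r f (i - 1, j) = f (i - 1, j)" "toggle p r f (i, j - 1) = f (i, j - 1)"
      unfolding toggle_def by auto
    hence eq: "toggle p r (toggle p r f) (i, j) =
        min (f (Suc i, j)) (f (i, Suc j)) + max (f (i - 1, j)) (f (i, j - 1)) - toggle p r f (i, j)"
      using toggle_diagonal(1)[OF toggle_in_rpp[OF f], of i j] True by simp
    have swap: "M + m - (M + m - x) = x" if "m \<le> x" "x \<le> M" for m x M :: nat
      using that by linarith
    from True have ij: "0 < i" "i \<le> p" "0 < j" "i + r = j + p" by auto
    show ?thesis
      unfolding b eq toggle_diagonal(1)[OF f ij]
      by (rule swap[OF toggle_diagonal(2,3)[OF f ij]])
  qed (auto simp: b toggle_def)
qed

lemma bij_toggle: "bij_betw (toggle p r) (rpp Y') (rpp Y')"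
  by (rule bij_betw_byWitness[where f' = "toggle p r"]) (auto simp: toggle_toggle toggle_in_rpp)

lemma extend_in_rpp:
  assumes f: "f \<in> rpp Y"
  shows "extend p r f a \<in> rpp Y'"
proof -
  have mono: "f (i - 1, j) \<le> f (i, j)" "f (i, j - 1) \<le> f (i, j)" if "(i, j) \<in> Y" for i j
    using f that unfolding rpp_def by blast+
  have neq: "(i - 1, j) \<noteq> (Suc p, Suc r)" "(i, j - 1) \<noteq> (Suc p, Suc r)" if "(i, j) \<in> Y" for i j
    using that not_mem_Y'I[of "Suc (Suc p)" "Suc r"] not_mem_Y'I[of "Suc p" "Suc (Suc r)"]
    by (cases i; cases j; auto)+
  show ?thesis
    unfolding rpp_def
  proof (intro CollectI conjI allI impI)
    fix i j assume "(i, j) \<in> Y'"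
    thus "extend p r f a (i - 1, j) \<le> extend p r f a (i, j)"
      "extend p r f a (i, j - 1) \<le> extend p r f a (i, j)"
      using mono[of i j] neq[of i j] new by (cases "(i, j) = (Suc p, Suc r)"; auto simp: extend_def)+
  qed (use f in \<open>auto simp: rpp_def arr_def extend_def\<close>)
qed

lemma restrict_in_rpp:
  assumes f: "f \<in> rpp Y'"
  shows "f((Suc p, Suc r) := 0) \<in> rpp Y"
proof -
  have mono: "f (i - 1, j) \<le> f (i, j)" "f (i, j - 1) \<le> f (i, j)" if "(i, j) \<in> Y'" for i j
    using f that unfolding rpp_def by blast+
  show ?thesis
    unfolding rpp_def
  proof (intro CollectI conjI allI impI)
    fix i j assume "(i, j) \<in> Y"
    hence "(i, j) \<noteq> (Suc p, Suc r)" "(i, j) \<in> Y'" using new by auto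
    with mono[of i j] new show "(f((Suc p, Suc r) := 0)) (i - 1, j) \<le> (f((Suc p, Suc r) := 0)) (i, j)"
      "(f((Suc p, Suc r) := 0)) (i, j - 1) \<le> (f((Suc p, Suc r) := 0)) (i, j)"
      by (auto simp del: insert_iff)
  qed (use f in \<open>auto simp: rpp_def arr_def\<close>)
qed

lemma bij_extend: "bij_betw (\<lambda>(f, a). extend p r f a) (rpp Y \<times> UNIV) (rpp Y')"
proof (rule bij_betw_byWitness[where f' = "\<lambda>f. (f((Suc p, Suc r) := 0),
           f (Suc p, Suc r) - max (f (p, Suc r)) (f (Suc p, r)))"])
  have "(Suc p, Suc r) \<in> Y'" by simp
  hence "f (p, Suc r) \<le> f (Suc p, Suc r)" "f (Suc p, r) \<le> f (Suc p, Suc r)" if "f \<in> rpp Y'" for f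
    using that unfolding rpp_def by force+
  thus "\<forall>f\<in>rpp Y'. (\<lambda>(f, a). extend p r f a) (f((Suc p, Suc r) := 0),
           f (Suc p, Suc r) - max (f (p, Suc r)) (f (Suc p, r))) = f"
    by (auto simp: extend_def)
  have "f (Suc p, Suc r) = 0" if "f \<in> rpp Y" for f
    using that new by (auto simp: rpp_def arr_def)
  thus "\<forall>x\<in>rpp Y \<times> UNIV. (\<lambda>f. (f((Suc p, Suc r) := 0),
           f (Suc p, Suc r) - max (f (p, Suc r)) (f (Suc p, r)))) ((\<lambda>(f, a). extend p r f a) x) = x"
    by (auto simp: extend_def)
qed (auto simp: extend_in_rpp restrict_in_rpp)

lemma bij_split: "bij_betw (\<lambda>A. (A((Suc p, Suc r) := 0), A (Suc p, Suc r))) (arr Y') (arr Y \<times> UNIV)"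
  by (rule bij_betw_byWitness[where f' = "\<lambda>(A, a). A((Suc p, Suc r) := a)"])
    (use new in \<open>auto simp: arr_def fun_eq_iff\<close>)

text \<open>The minimum taken at one cell of the diagonal and the maximum taken at the next one involve the
  same two neighbours, so the toggled diagonal sums telescope.\<close>

lemma diag_sum_toggle:
  assumes f: "f \<in> rpp Y'" and ij: "i \<le> p" "i + r = j + p"
  shows "diag_sum (toggle p r f) i j + diag_sum f i j + max (f (i, Suc j)) (f (Suc i, j))
           = diag_sum f i (Suc j) + diag_sum f (Suc i) j"
  using ij
proof (induction i arbitrary: j)
  case 0
  thus ?case using rpp_zero[OF young' f] by (cases j) auto
next
  case (Suc i j')
  show ?case
  proof (cases j')
    case 0
    thus ?thesis using rpp_zero[OF young' f] by auto
  next
    case j': (Suc j)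
    have "toggle p r f (Suc i, Suc j) + f (Suc i, Suc j) =
      min (f (Suc (Suc i), Suc j)) (f (Suc i, Suc (Suc j))) + max (f (i, Suc j)) (f (Suc i, j))"
      using Suc.prems j' rpp_diagonal[OF f, of "Suc i" "Suc j"] by (auto simp: toggle_def)
    moreover have "diag_sum (toggle p r f) i j + diag_sum f i j + max (f (i, Suc j)) (f (Suc i, j))
             = diag_sum f i (Suc j) + diag_sum f (Suc i) j"
      using Suc.prems j' by (intro Suc.IH) auto
    ultimately show ?thesis by (auto simp: j' min_def max_def split: if_splits)
  qed
qed

text \<open>The local growth rule: \<open>rect_sum_Suc\<close> with \<open>a\<close> as the entry at
  the new corner. It carries the equality of \<open>diag_sum\<close> and \<open>rect_sum\<close>
  over to the larger shape.\<close>

lemma diag_sum_toggle_extend: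
  assumes f: "f \<in> rpp Y"
  shows "diag_sum (toggle p r (extend p r f a)) (Suc p) (Suc r) + diag_sum f p r
           = a + diag_sum f p (Suc r) + diag_sum f (Suc p) r"
proof -
  let ?g = "extend p r f a"
  have g: "?g \<in> rpp Y'" using extend_in_rpp[OF f] .
  have "diag_sum ?g p r = diag_sum f p r" "diag_sum ?g p (Suc r) = diag_sum f p (Suc r)"
       "diag_sum ?g (Suc p) r = diag_sum f (Suc p) r"
    by (rule diag_sum_cong; simp add: extend_def)+
  moreover have "toggle p r ?g (Suc p, Suc r) = a + max (?g (p, Suc r)) (?g (Suc p, r))"
    by (simp add: toggle_def extend_def)
  ultimately show ?thesis
    using diag_sum_toggle[OF g, of p r] by simp
qed

lemma toggle_extend_off_diagonal:
  assumes "i + r \<noteq> j + p"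
  shows "diag_sum (toggle p r (extend p r f a)) i j = diag_sum f i j"
  by (rule diag_sum_cong) (use assms in \<open>auto simp: toggle_def extend_def\<close>)

end

section \<open>Building the bijection cell by cell\<close>

text \<open>The place where a diagonal leaves the shape. A diagonal that misses \<open>Y\<close> is
  represented by its border index, where both sums vanish.\<close>

definition diag_end :: "(nat \<times> nat) set \<Rightarrow> nat \<Rightarrow> nat \<Rightarrow> bool" where
  "diag_end Y i j \<longleftrightarrow> (i = 0 \<or> j = 0 \<or> (i, j) \<in> Y) \<and> (Suc i, Suc j) \<notin> Y"

text \<open>A cell with maximal \<open>i + j\<close> has no other cell of \<open>Y\<close> weakly to
  its lower right, so removing it leaves a Young diagram.\<close>

lemma young_remove_corner:
  assumes "young Y" "Y \<noteq> {}"
  obtains p r Y0 where "young Y0" "Y = insert (Suc p, Suc r) Y0" "(Suc p, Suc r) \<notin> Y0"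
proof -
  have fin: "finite Y" using assms by (simp add: young_def)
  define m where "m = Max ((\<lambda>(i, j). i + j) ` Y)"
  have "m \<in> (\<lambda>(i, j). i + j) ` Y" unfolding m_def using fin assms by (intro Max_in) auto
  then obtain i j where ij: "(i, j) \<in> Y" "i + j = m" by auto
  have le: "i' + j' \<le> m" if "(i', j') \<in> Y" for i' j'
    unfolding m_def using fin that by (intro Max_ge) force+
  obtain p r where pr: "i = Suc p" "j = Suc r"
    using ij assms unfolding young_def by (metis gr0_implies_Suc)
  have "young (Y - {(i, j)})"
    unfolding young_def
  proof (intro conjI allI impI)
    fix a b a' b' assume *: "(a, b) \<in> Y - {(i, j)}" "0 < a'" "a' \<le> a" "0 < b'" "b' \<le> b"
    hence "(a', b') \<in> Y" using assms(1) unfolding young_def by blast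
    moreover have "(a', b') \<noteq> (i, j)"
      using * le[of a b] ij by auto
    ultimately show "(a', b') \<in> Y - {(i, j)}" by simp
  qed (use assms(1) fin in \<open>auto simp: young_def\<close>)
  thus thesis using that[of "Y - {(i, j)}" p r] ij pr by auto
qed

text \<open>Growth-diagram form of the Robinson--Schensted--Knuth correspondence, built up one grid of
  the shape at a time.\<close>

lemma rsk_bijection:
  assumes "young Y"
  shows "\<exists>\<Phi>. bij_betw \<Phi> (arr Y) (rpp Y) \<and>
    (\<forall>A\<in>arr Y. \<forall>i j. diag_end Y i j \<longrightarrow> diag_sum (\<Phi> A) i j = rect_sum A i j)"
  using assms
proof (induction "card Y" arbitrary: Y)
  case 0
  hence "Y = {}" by (simp add: young_def)
  have "bij_betw id (arr Y) (rpp Y)" by (auto simp: \<open>Y = {}\<close> arr_def rpp_def)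
  moreover have "diag_sum (id A) i j = rect_sum A i j" if "A \<in> arr Y" "diag_end Y i j" for A i j
    using that by (auto simp: \<open>Y = {}\<close> diag_end_def rect_sum_def)
  ultimately show ?case by blast
next
  case (Suc k)
  then obtain p r Y0 where Y0: "young Y0" "Y = insert (Suc p, Suc r) Y0" "(Suc p, Suc r) \<notin> Y0"
    using young_remove_corner[of Y] by (metis Zero_not_Suc card.empty)
  have fin: "finite Y0" using Y0 by (simp add: young_def)
  note ctx = Y0(1) Suc.prems[unfolded Y0(2)] Y0(3)
  have "k = card Y0" using Suc.hyps(2) fin Y0 by simp
  from Suc.hyps(1)[OF this Y0(1)] obtain \<Phi> where
    \<Phi>: "bij_betw \<Phi> (arr Y0) (rpp Y0)"
    and \<Phi>_diag: "\<And>A i j. A \<in> arr Y0 \<Longrightarrow> diag_end Y0 i j \<Longrightarrow> diag_sum (\<Phi> A) i j = rect_sum A i j"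
    by blast
  let ?c = "(Suc p, Suc r)"
  define \<Psi> where "\<Psi> = (\<lambda>A. toggle p r (extend p r (\<Phi> (A(?c := 0))) (A ?c)))"
  have "\<Psi> = toggle p r \<circ> ((\<lambda>(f, a). extend p r f a) \<circ> (map_prod \<Phi> id \<circ> (\<lambda>A. (A(?c := 0), A ?c))))"
    by (auto simp: \<Psi>_def)
  moreover have "bij_betw (map_prod \<Phi> id) (arr Y0 \<times> UNIV) (rpp Y0 \<times> (UNIV :: nat set))"
    using \<Phi> by (intro bij_betw_map_prod) auto
  ultimately have bij: "bij_betw \<Psi> (arr Y) (rpp Y)"
    using bij_split[OF ctx] bij_extend[OF ctx] bij_toggle[OF ctx] Y0(2)
    by (auto intro!: bij_betw_trans)
  have "diag_sum (\<Psi> A) i j = rect_sum A i j" if A: "A \<in> arr Y" and e: "diag_end Y i j" for A i j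
  proof -
    have A0: "A(?c := 0) \<in> arr Y0" using A Y0 by (auto simp: arr_def)
    have f: "\<Phi> (A(?c := 0)) \<in> rpp Y0" using \<Phi> A0 by (auto simp: bij_betw_def)
    have rect: "rect_sum (A(?c := 0)) a b = rect_sum A a b" if "a \<le> p \<or> b \<le> r" for a b
      unfolding rect_sum_def by (intro sum.cong) (use that in auto)
    have mem: "(a, b) \<in> Y" if "0 < a" "a \<le> Suc p" "0 < b" "b \<le> Suc r" for a b
      using mem_Y'I[OF ctx that] Y0 by simp
    have nmem: "(a, b) \<notin> Y" if "Suc p \<le> a" "Suc r \<le> b" "(a, b) \<noteq> ?c" for a b
      using not_mem_Y'I[OF ctx that] Y0 by simp
    show ?thesis
    proof (cases "(i, j) = ?c")
      case True
      \<comment> \<open>Without the corner, its upper-left neighbours become the ends of their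
        diagonals, or border indices when \<open>p\<close> or \<open>r\<close> is 0, so the
        induction hypothesis applies to all three.\<close>
      have ends: "diag_end Y0 p r" "diag_end Y0 p (Suc r)" "diag_end Y0 (Suc p) r"
        using mem[of p r] mem[of p "Suc r"] mem[of "Suc p" r]
          nmem[of "Suc p" "Suc (Suc r)"] nmem[of "Suc (Suc p)" "Suc r"] Y0
        by (auto simp: diag_end_def)
      show ?thesis
        using diag_sum_toggle_extend[OF ctx f, of "A ?c"] rect_sum_Suc[of A p r]
          \<Phi>_diag[OF A0 ends(1)] \<Phi>_diag[OF A0 ends(2)] \<Phi>_diag[OF A0 ends(3)] True
        by (simp add: \<Psi>_def rect)
    next
      case False
      \<comment> \<open>The toggled diagonal has its end in \<open>Y\<close> at the new corner,
        which is not \<open>(i, j)\<close>.\<close>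
      have off: "i + r \<noteq> j + p"
      proof
        assume *: "i + r = j + p"
        show False
        proof (cases "i \<le> p")
          case True
          hence "(Suc i, Suc j) \<in> Y" using * by (intro mem) auto
          thus False using e by (simp add: diag_end_def)
        next
          case F: False
          hence "Suc p \<le> i" "Suc r \<le> j" using * by auto
          with nmem[OF this False] e show False by (auto simp: diag_end_def)
        qed
      qed
      have e0: "diag_end Y0 i j"
        using e False Y0 by (auto simp: diag_end_def)
      have "i \<le> p \<or> j \<le> r"
        using nmem[of i j] False e by (force simp: diag_end_def not_less_eq_eq)
      thus ?thesis
        using toggle_extend_off_diagonal[OF ctx off] \<Phi>_diag[OF A0 e0]
        by (simp add: \<Psi>_def rect)
    qed
  qed
  with bij show ?case by blast
qed

section \<open>Square shapes and hook lengths\<close>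

definition grid :: "nat \<Rightarrow> (nat \<times> nat) set" where
  "grid N = {1..N} \<times> {1..N}"

lemma young_grid: "young (grid N)"
  by (auto simp: young_def grid_def)

text \<open>Every diagonal of the square ends in the last row or the last column;
  \<open>{1..<N}\<close> keeps the main diagonal from being counted twice. The induction strips the
  last cell off each diagonal.\<close>

lemma sum_grid_eq_diag_sum:
  "(\<Sum>i\<in>{1..N}. \<Sum>j\<in>{1..N}. f (i, j)) = (\<Sum>j\<in>{1..N}. diag_sum f N j) + (\<Sum>i\<in>{1..<N}. diag_sum f i N)"
proof (induction N)
  case (Suc N)
  have "(\<Sum>j\<in>{1..Suc N}. diag_sum f (Suc N) j) = (\<Sum>j\<in>{0..N}. diag_sum f (Suc N) (Suc j))"
    by (simp only: One_nat_def sum.shift_bounds_cl_Suc_ivl)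
  also have "\<dots> = (\<Sum>j\<in>{0..N}. f (Suc N, Suc j)) + (\<Sum>j\<in>{0..N}. diag_sum f N j)"
    by (simp add: sum.distrib)
  also have "(\<Sum>j\<in>{0..N}. f (Suc N, Suc j)) = (\<Sum>j\<in>{1..Suc N}. f (Suc N, j))"
    by (simp only: One_nat_def sum.shift_bounds_cl_Suc_ivl)
  also have "(\<Sum>j\<in>{0..N}. diag_sum f N j) = (\<Sum>j\<in>{1..N}. diag_sum f N j)"
    by (intro sum.mono_neutral_right) (auto simp: not_less_eq_eq)
  finally have 1: "(\<Sum>j\<in>{1..Suc N}. diag_sum f (Suc N) j) =
    (\<Sum>j\<in>{1..Suc N}. f (Suc N, j)) + (\<Sum>j\<in>{1..N}. diag_sum f N j)" .
  have "(\<Sum>i\<in>{1..<Suc N}. diag_sum f i (Suc N)) = (\<Sum>i\<in>{0..<N}. diag_sum f (Suc i) (Suc N))"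
    by (simp only: One_nat_def sum.shift_bounds_Suc_ivl)
  also have "\<dots> = (\<Sum>i\<in>{0..<N}. f (Suc i, Suc N)) + (\<Sum>i\<in>{0..<N}. diag_sum f i N)"
    by (simp add: sum.distrib)
  also have "(\<Sum>i\<in>{0..<N}. f (Suc i, Suc N)) = (\<Sum>i\<in>{1..<Suc N}. f (i, Suc N))"
    by (simp only: One_nat_def sum.shift_bounds_Suc_ivl)
  also have "{1..<Suc N} = {1..N}" by auto
  also have "(\<Sum>i\<in>{0..<N}. diag_sum f i N) = (\<Sum>i\<in>{1..<N}. diag_sum f i N)"
  proof (rule sum.mono_neutral_right)
    show "\<forall>i\<in>{0..<N} - {1..<N}. diag_sum f i N = 0"
    proof
      fix i assume "i \<in> {0..<N} - {1..<N}"
      hence "i = 0" by auto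
      thus "diag_sum f i N = 0" by simp
    qed
  qed auto
  finally have 2: "(\<Sum>i\<in>{1..<Suc N}. diag_sum f i (Suc N)) =
    (\<Sum>i\<in>{1..N}. f (i, Suc N)) + (\<Sum>i\<in>{1..<N}. diag_sum f i N)"
    by (simp only: atLeastLessThanSuc_atLeastAtMost)
  have "(\<Sum>i\<in>{1..Suc N}. \<Sum>j\<in>{1..Suc N}. f (i, j)) =
      (\<Sum>i\<in>{1..N}. \<Sum>j\<in>{1..N}. f (i, j)) + (\<Sum>i\<in>{1..N}. f (i, Suc N)) + (\<Sum>j\<in>{1..Suc N}. f (Suc N, j))"
    by (simp add: sum.distrib)
  thus ?case unfolding 1 2 Suc.IH by simp
qed auto

text \<open>The cell \<open>(i, j)\<close> lies in \<open>N + 1 - j\<close> of the full-height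
  rectangles and in \<open>N - i\<close> of the full-width ones; together this is its hook length in
  the square.\<close>

lemma sum_rect_sum_grid:
  "(\<Sum>j\<in>{1..N}. rect_sum A N j) + (\<Sum>i\<in>{1..<N}. rect_sum A i N)
     = (\<Sum>i\<in>{1..N}. \<Sum>j\<in>{1..N}. A (i, j) * (2 * N + 1 - i - j))"
proof -
  have 1: "(\<Sum>j\<in>{1..N}. rect_sum A N j) = (\<Sum>i\<in>{1..N}. \<Sum>j\<in>{1..N}. A (i, j) * (N + 1 - j))"
  proof -
    have "(\<Sum>j\<in>{1..N}. rect_sum A N j) =
        (\<Sum>j\<in>{1..N}. \<Sum>i\<in>{1..N}. \<Sum>j'\<in>{1..N}. if j' \<le> j then A (i, j') else 0)"
    proof (rule sum.cong[OF refl])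
      fix j assume "j \<in> {1..N}"
      hence "{1..N} \<inter> {j'. j' \<le> j} = {1..j}" by auto
      thus "rect_sum A N j = (\<Sum>i\<in>{1..N}. \<Sum>j'\<in>{1..N}. if j' \<le> j then A (i, j') else 0)"
        by (simp add: rect_sum_def sum.If_cases)
    qed
    also have "\<dots> = (\<Sum>i\<in>{1..N}. \<Sum>j'\<in>{1..N}. \<Sum>j\<in>{1..N}. if j' \<le> j then A (i, j') else 0)"
      by (rule trans[OF sum.swap], rule sum.cong[OF refl], rule sum.swap)
    also have "\<dots> = (\<Sum>i\<in>{1..N}. \<Sum>j'\<in>{1..N}. A (i, j') * (N + 1 - j'))"
    proof (intro sum.cong refl)
      fix i j' assume "j' \<in> {1..N}"
      hence "{1..N} \<inter> {j. j' \<le> j} = {j'..N}" by auto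
      thus "(\<Sum>j\<in>{1..N}. if j' \<le> j then A (i, j') else 0) = A (i, j') * (N + 1 - j')"
        by (simp add: sum.If_cases)
    qed
    finally show ?thesis .
  qed
  have 2: "(\<Sum>i\<in>{1..<N}. rect_sum A i N) = (\<Sum>i\<in>{1..N}. \<Sum>j\<in>{1..N}. A (i, j) * (N - i))"
  proof -
    have "(\<Sum>i\<in>{1..<N}. rect_sum A i N) =
        (\<Sum>i\<in>{1..<N}. \<Sum>i'\<in>{1..N}. if i' \<le> i then \<Sum>j\<in>{1..N}. A (i', j) else 0)"
    proof (rule sum.cong[OF refl])
      fix i assume "i \<in> {1..<N}"
      hence "{1..N} \<inter> {i'. i' \<le> i} = {1..i}" by auto
      thus "rect_sum A i N = (\<Sum>i'\<in>{1..N}. if i' \<le> i then \<Sum>j\<in>{1..N}. A (i', j) else 0)"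
        by (simp add: rect_sum_def sum.If_cases)
    qed
    also have "\<dots> = (\<Sum>i'\<in>{1..N}. \<Sum>i\<in>{1..<N}. if i' \<le> i then \<Sum>j\<in>{1..N}. A (i', j) else 0)"
      by (rule sum.swap)
    also have "\<dots> = (\<Sum>i'\<in>{1..N}. \<Sum>j\<in>{1..N}. A (i', j) * (N - i'))"
    proof (rule sum.cong[OF refl])
      fix i' assume "i' \<in> {1..N}"
      hence "{1..<N} \<inter> {i. i' \<le> i} = {i'..<N}" by auto
      thus "(\<Sum>i\<in>{1..<N}. if i' \<le> i then \<Sum>j\<in>{1..N}. A (i', j) else 0) = (\<Sum>j\<in>{1..N}. A (i', j) * (N - i'))"
        by (simp add: sum.If_cases sum_distrib_left mult.commute)
    qed
    finally show ?thesis .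
  qed
  show ?thesis
    unfolding 1 2 sum.distrib[symmetric]
    by (intro sum.cong refl) (auto simp: add_mult_distrib2[symmetric])
qed

lemma bij_betw_card_Collect:
  assumes "bij_betw \<Phi> A B" and "\<And>x. x \<in> A \<Longrightarrow> P x \<longleftrightarrow> Q (\<Phi> x)"
  shows "card {x \<in> A. P x} = card {y \<in> B. Q y}"
proof -
  have "bij_betw \<Phi> {x \<in> A. P x} {y \<in> B. Q y}"
    using assms unfolding bij_betw_def inj_on_def by blast
  thus ?thesis by (rule bij_betw_same_card)
qed

text \<open>For finite \<open>B\<close> and positive weights, the coefficient of
  \<open>x ^ n\<close> in the product of \<open>1 / (1 - x ^ w b)\<close> over \<open>b\<close> in
  \<open>B\<close>.\<close>

definition wcount :: "'b set \<Rightarrow> ('b \<Rightarrow> nat) \<Rightarrow> nat \<Rightarrow> nat" where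
  "wcount B w n = card {A \<in> arr B. (\<Sum>b\<in>B. A b * w b) = n}"

text \<open>Hook length of a cell of the square: arm \<open>N - j\<close>, leg \<open>N - i\<close>,
  and the cell itself.\<close>

definition antihook :: "nat \<Rightarrow> nat \<times> nat \<Rightarrow> nat" where
  "antihook N = (\<lambda>(i, j). 2 * N + 1 - i - j)"

text \<open>The total of a reverse plane partition is the sum of its diagonal sums, hence of
  rectangle sums of the array, where each entry is counted as often as its hook length says.\<close>

lemma card_rpp_grid:
  "card {f \<in> rpp (grid N). (\<Sum>b\<in>grid N. f b) = n} = wcount (grid N) (antihook N) n"
proof -
  obtain \<Phi> where bij: "bij_betw \<Phi> (arr (grid N)) (rpp (grid N))"
    and diag: "\<And>A i j. A \<in> arr (grid N) \<Longrightarrow> diag_end (grid N) i j \<Longrightarrow> diag_sum (\<Phi> A) i j = rect_sum A i j"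
    using rsk_bijection[OF young_grid[of N]] by blast
  have "(\<Sum>b\<in>grid N. A b * antihook N b) = (\<Sum>b\<in>grid N. \<Phi> A b)" if "A \<in> arr (grid N)" for A
  proof -
    have "diag_sum (\<Phi> A) N j = rect_sum A N j" if "j \<in> {1..N}" for j
      using that by (intro diag[OF \<open>A \<in> arr (grid N)\<close>]) (auto simp: diag_end_def grid_def)
    moreover have "diag_sum (\<Phi> A) i N = rect_sum A i N" if "i \<in> {1..<N}" for i
      using that by (intro diag[OF \<open>A \<in> arr (grid N)\<close>]) (auto simp: diag_end_def grid_def)
    ultimately have "(\<Sum>i\<in>{1..N}. \<Sum>j\<in>{1..N}. \<Phi> A (i, j)) = (\<Sum>i\<in>{1..N}. \<Sum>j\<in>{1..N}. A (i, j) * (2 * N + 1 - i - j))"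
      unfolding sum_grid_eq_diag_sum sum_rect_sum_grid[symmetric] by simp
    thus ?thesis
      by (simp add: grid_def sum.cartesian_product antihook_def case_prod_unfold)
  qed
  thus ?thesis
    unfolding wcount_def using bij_betw_card_Collect[OF bij, of "\<lambda>A. (\<Sum>b\<in>grid N. A b * antihook N b) = n"
       "\<lambda>f. (\<Sum>b\<in>grid N. f b) = n"] by simp
qed

section \<open>Plane partitions inside a square\<close>

text \<open>By monotonicity a nonzero entry forces \<open>i + 1\<close> nonzero entries in its
  column and \<open>j + 1\<close> in its row, and at most \<open>n\<close> entries are
  nonzero.\<close>

lemma plane_partition_support:
  assumes "plane_partition n \<pi>" "n \<le> N" "\<pi> i j \<noteq> 0"
  shows "i < N \<and> j < N"
proof -
  have row: "\<pi> i (Suc j) \<le> \<pi> i j" and col: "\<pi> (Suc i) j \<le> \<pi> i j" for i j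
    using assms(1) by (auto simp: plane_partition_def)
  have row': "\<pi> i j \<le> \<pi> i j'" if "j' \<le> j" for i j j'
    using that by (rule lift_Suc_antimono_le[where f = "\<pi> i", OF row])
  have col': "\<pi> i j \<le> \<pi> i' j" if "i' \<le> i" for i j i'
    using that by (rule lift_Suc_antimono_le[where f = "\<lambda>i. \<pi> i j", OF col])
  let ?S = "{(i, j). \<pi> i j \<noteq> 0}"
  have fin: "finite ?S" and sum: "(\<Sum>(i, j)\<in>?S. \<pi> i j) = n"
    using assms(1) by (auto simp: plane_partition_def)
  have "card ?S = (\<Sum>b\<in>?S. 1)" by simp
  also have "\<dots> \<le> (\<Sum>(i, j)\<in>?S. \<pi> i j)" by (intro sum_mono) auto
  finally have card: "card ?S \<le> N" using sum assms(2) by simp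
  have "(\<lambda>i'. (i', j)) ` {..i} \<subseteq> ?S"
    using col'[of _ i j] assms(3) by fastforce
  hence "card ((\<lambda>i'. (i', j)) ` {..i}) \<le> card ?S" by (rule card_mono[OF fin])
  moreover have "card ((\<lambda>i'. (i', j)) ` {..i}) = Suc i"
    by (subst card_image) (auto simp: inj_on_def)
  moreover have "(\<lambda>j'. (i, j')) ` {..j} \<subseteq> ?S"
    using row'[of _ j i] assms(3) by fastforce
  hence "card ((\<lambda>j'. (i, j')) ` {..j}) \<le> card ?S" by (rule card_mono[OF fin])
  moreover have "card ((\<lambda>j'. (i, j')) ` {..j}) = Suc j"
    by (subst card_image) (auto simp: inj_on_def)
  ultimately show ?thesis using card by linarith
qed

lemma pp_eq_card_rpp:
  assumes "n \<le> N"
  shows "pp n = card {f \<in> rpp (grid N). (\<Sum>b\<in>grid N. f b) = n}"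
proof -
  \<comment> \<open>The map \<open>N - i\<close> both reverses the order and changes the indices
    \<open>0..N-1\<close> into \<open>N..1\<close>.\<close>
  let ?F = "\<lambda>\<pi> (i, j). if (i, j) \<in> grid N then \<pi> (N - i) (N - j) else (0 :: nat)"
  let ?G = "\<lambda>f i j. f (N - i, N - j) :: nat"
  have sum_flip: "(\<Sum>(i, j)\<in>grid N. g (N - i) (N - j)) = (\<Sum>(i, j)\<in>{..<N} \<times> {..<N}. g i j)"
    for g :: "nat \<Rightarrow> nat \<Rightarrow> nat"
    by (rule sum.reindex_bij_witness[where i = "\<lambda>(i, j). (N - i, N - j)" and j = "\<lambda>(i, j). (N - i, N - j)"])
      (auto simp: grid_def)
  have sum_supp: "(\<Sum>(i, j)\<in>{(i, j). \<pi> i j \<noteq> 0}. \<pi> i j) = (\<Sum>(i, j)\<in>{..<N} \<times> {..<N}. \<pi> i j)"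
    if "\<And>i j. \<pi> i j \<noteq> 0 \<Longrightarrow> i < N \<and> j < N" for \<pi> :: "nat \<Rightarrow> nat \<Rightarrow> nat"
    by (rule sum.mono_neutral_left) (use that in force)+
  have "bij_betw ?F {\<pi>. plane_partition n \<pi>} {f \<in> rpp (grid N). (\<Sum>b\<in>grid N. f b) = n}"
  proof (rule bij_betw_byWitness[where f' = ?G])
    show "\<forall>\<pi>\<in>{\<pi>. plane_partition n \<pi>}. ?G (?F \<pi>) = \<pi>"
      using plane_partition_support[OF _ assms] by (fastforce simp: fun_eq_iff grid_def)
    show "\<forall>f\<in>{f \<in> rpp (grid N). (\<Sum>b\<in>grid N. f b) = n}. ?F (?G f) = f"
      by (auto simp: fun_eq_iff grid_def rpp_def arr_def)
    show "?F ` {\<pi>. plane_partition n \<pi>} \<subseteq> {f \<in> rpp (grid N). (\<Sum>b\<in>grid N. f b) = n}"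
    proof safe
      fix \<pi> assume \<pi>: "plane_partition n \<pi>"
      hence row: "\<pi> i (Suc j) \<le> \<pi> i j" and col: "\<pi> (Suc i) j \<le> \<pi> i j" for i j
        by (auto simp: plane_partition_def)
      show "?F \<pi> \<in> rpp (grid N)"
        unfolding rpp_def
      proof (intro CollectI conjI allI impI)
        fix i j assume ij: "(i, j) \<in> grid N"
        hence "Suc (N - i) = N - (i - 1)" "Suc (N - j) = N - (j - 1)" by (auto simp: grid_def)
        with ij row[of "N - i" "N - j"] col[of "N - i" "N - j"]
        show "?F \<pi> (i - 1, j) \<le> ?F \<pi> (i, j)" "?F \<pi> (i, j - 1) \<le> ?F \<pi> (i, j)" by simp_all
      qed (auto simp: arr_def)
      have "(\<Sum>b\<in>grid N. ?F \<pi> b) = (\<Sum>(i, j)\<in>grid N. \<pi> (N - i) (N - j))"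
        by (intro sum.cong) auto
      also have "\<dots> = n"
        unfolding sum_flip using sum_supp[OF plane_partition_support[OF \<pi> assms]] \<pi>
        by (simp add: plane_partition_def)
      finally show "(\<Sum>b\<in>grid N. ?F \<pi> b) = n" .
    qed
    show "?G ` {f \<in> rpp (grid N). (\<Sum>b\<in>grid N. f b) = n} \<subseteq> {\<pi>. plane_partition n \<pi>}"
    proof safe
      fix f assume f: "f \<in> rpp (grid N)" and n: "n = (\<Sum>b\<in>grid N. f b)"
      have zero: "f b = 0" if "b \<notin> grid N" for b
        using f that unfolding rpp_def arr_def by blast
      have supp: "i < N \<and> j < N" if "f (N - i, N - j) \<noteq> 0" for i j
      proof -
        have "(N - i, N - j) \<in> grid N" by (rule ccontr) (use zero[of "(N - i, N - j)"] that in simp)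
        thus ?thesis by (auto simp: grid_def)
      qed
      have mono: "f (i - 1, j) \<le> f (i, j)" "f (i, j - 1) \<le> f (i, j)" if "i \<le> N" "j \<le> N" for i j
      proof -
        have "f (i - 1, j) \<le> f (i, j) \<and> f (i, j - 1) \<le> f (i, j)"
        proof (cases "(i, j) \<in> grid N")
          case True
          with f show ?thesis unfolding rpp_def by blast
        next
          case False
          hence "(i - 1, j) \<notin> grid N" "(i, j - 1) \<notin> grid N" using that by (auto simp: grid_def)
          thus ?thesis by (simp add: zero)
        qed
        thus "f (i - 1, j) \<le> f (i, j)" "f (i, j - 1) \<le> f (i, j)" by simp_all
      qed
      show "plane_partition (\<Sum>b\<in>grid N. f b) (?G f)"
        unfolding plane_partition_def
      proof (intro conjI allI)
        show "f (N - i, N - Suc j) \<le> f (N - i, N - j)" "f (N - Suc i, N - j) \<le> f (N - i, N - j)" for i j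
          using mono[of "N - i" "N - j"] by simp_all
        show "finite {(i, j). f (N - i, N - j) \<noteq> 0}"
          by (rule finite_subset[of _ "{..<N} \<times> {..<N}"]) (use supp in auto)
        have "(\<Sum>(i, j)\<in>{..<N} \<times> {..<N}. f (N - i, N - j)) = (\<Sum>(i, j)\<in>grid N. f (N - (N - i), N - (N - j)))"
          by (rule sum_flip[symmetric])
        also have "\<dots> = (\<Sum>b\<in>grid N. f b)" by (intro sum.cong) (auto simp: grid_def)
        finally show "(\<Sum>(i, j)\<in>{(i, j). f (N - i, N - j) \<noteq> 0}. f (N - i, N - j)) = (\<Sum>b\<in>grid N. f b)"
          using sum_supp[OF supp] by simp
      qed
    qed
  qed
  thus ?thesis unfolding pp_def by (rule bij_betw_same_card)
qed

section \<open>The recurrence by double counting\<close>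

lemma finite_arr_weight:
  assumes "finite B" "\<And>b. b \<in> B \<Longrightarrow> 0 < w b"
  shows "finite {A \<in> arr B. (\<Sum>b\<in>B. A b * w b) = n}" (is "finite ?S")
proof -
  have le: "A b \<le> n" if "A \<in> ?S" for A b
  proof (cases "b \<in> B")
    case True
    have "A b \<le> A b * w b" using assms(2)[OF True] by simp
    also have "\<dots> \<le> (\<Sum>b\<in>B. A b * w b)" using assms(1) True by (intro member_le_sum) auto
    finally show ?thesis using that by simp
  qed (use that in \<open>auto simp: arr_def\<close>)
  have "?S \<subseteq> {A. \<forall>b. (b \<in> B \<longrightarrow> A b \<in> {..n}) \<and> (b \<notin> B \<longrightarrow> A b = 0)}"
    using le by (auto simp: arr_def)
  thus ?thesis by (rule finite_subset) (intro finite_set_of_finite_funs assms(1) finite_atMost)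
qed

lemma wcount_shift:
  assumes "finite B" "b \<in> B"
  shows "card {A \<in> arr B. (\<Sum>b\<in>B. A b * w b) = m + l * w b \<and> l \<le> A b} = wcount B w m"
proof -
  have upd: "(\<Sum>c\<in>B. (A(b := x)) c * w c) + A b * w b = (\<Sum>c\<in>B. A c * w c) + x * w b"
    for A :: "'a \<Rightarrow> nat" and x
    using assms by (simp add: sum.remove[of B b])
  have "bij_betw (\<lambda>A. A(b := A b + l)) {A \<in> arr B. (\<Sum>c\<in>B. A c * w c) = m}
      {A \<in> arr B. (\<Sum>c\<in>B. A c * w c) = m + l * w b \<and> l \<le> A b}"
  proof (rule bij_betw_byWitness[where f' = "\<lambda>A. A(b := A b - l)"])
    show "(\<lambda>A. A(b := A b + l)) ` {A \<in> arr B. (\<Sum>c\<in>B. A c * w c) = m} \<subseteq>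
      {A \<in> arr B. (\<Sum>c\<in>B. A c * w c) = m + l * w b \<and> l \<le> A b}"
    proof safe
      fix A assume A: "A \<in> arr B"
      show "(\<Sum>c\<in>B. (A(b := A b + l)) c * w c) = (\<Sum>c\<in>B. A c * w c) + l * w b"
        using upd[of A "A b + l"] by (simp add: algebra_simps del: fun_upd_apply)
    qed (use assms in \<open>auto simp: arr_def\<close>)
    show "(\<lambda>A. A(b := A b - l)) ` {A \<in> arr B. (\<Sum>c\<in>B. A c * w c) = m + l * w b \<and> l \<le> A b} \<subseteq>
       {A \<in> arr B. (\<Sum>c\<in>B. A c * w c) = m}"
    proof safe
      fix A assume A: "A \<in> arr B" "(\<Sum>c\<in>B. A c * w c) = m + l * w b" "l \<le> A b"
      show "(\<Sum>c\<in>B. (A(b := A b - l)) c * w c) = m"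
        using upd[of A "A b - l"] A by (simp add: diff_mult_distrib del: fun_upd_apply)
    qed (use assms in \<open>auto simp: arr_def\<close>)
  qed auto
  thus ?thesis unfolding wcount_def by (rule bij_betw_same_card[symmetric])
qed

text \<open>Double counting of \<open>n = (\<Sum>b\<in>B. A b * w b)\<close> over all arrays \<open>A\<close> of weight \<open>n\<close>: the
  arrays with \<open>l \<le> A b\<close> correspond to all arrays of weight \<open>n - l * w b\<close>.\<close>

lemma wcount_recurrence:
  assumes fin: "finite B" and pos: "\<And>b. b \<in> B \<Longrightarrow> 0 < w b"
  shows "n * wcount B w n = (\<Sum>k\<in>{1..n}. (\<Sum>b\<in>{b \<in> B. w b dvd k}. w b) * wcount B w (n - k))"
proof -
  define S where "S = {A \<in> arr B. (\<Sum>b\<in>B. A b * w b) = n}"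
  have finS: "finite S" unfolding S_def by (rule finite_arr_weight[OF assms])
  have per_cell: "(\<Sum>A\<in>S. A b) = (\<Sum>k\<in>{1..n}. if w b dvd k then wcount B w (n - k) else 0)"
    if b: "b \<in> B" for b
  proof -
    have le: "A b * w b \<le> n" if "A \<in> S" for A
      using that member_le_sum[of b B "\<lambda>b. A b * w b"] fin b by (auto simp: S_def)
    have le': "A b \<le> n" if "A \<in> S" for A
      using le[OF that] pos[OF b] by (metis mult_le_mono2 nat_mult_1_right One_nat_def Suc_leI le_trans)
    have "(\<Sum>A\<in>S. A b) = (\<Sum>A\<in>S. \<Sum>l\<in>{1..n}. if l \<le> A b then 1 else 0)"
    proof (rule sum.cong[OF refl])
      fix A assume "A \<in> S"
      hence "{1..n} \<inter> {l. l \<le> A b} = {1..A b}" using le'[of A] by auto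
      thus "A b = (\<Sum>l\<in>{1..n}. if l \<le> A b then 1 else 0)" by (simp add: sum.If_cases)
    qed
    also have "\<dots> = (\<Sum>l\<in>{1..n}. \<Sum>A\<in>S. if l \<le> A b then 1 else 0)" by (rule sum.swap)
    also have "\<dots> = (\<Sum>l\<in>{1..n}. if l * w b \<le> n then wcount B w (n - l * w b) else 0)"
    proof (rule sum.cong[OF refl])
      fix l
      have "(\<Sum>A\<in>S. if l \<le> A b then 1 else 0) = card {A \<in> S. l \<le> A b}"
        using finS by (simp add: sum.If_cases Int_def conj_commute)
      also have "\<dots> = (if l * w b \<le> n then wcount B w (n - l * w b) else 0)"
      proof (cases "l * w b \<le> n")
        case True
        hence "{A \<in> S. l \<le> A b} =
            {A \<in> arr B. (\<Sum>b\<in>B. A b * w b) = n - l * w b + l * w b \<and> l \<le> A b}"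
          by (auto simp: S_def)
        with True show ?thesis using wcount_shift[OF fin b, of w "n - l * w b" l] by simp
      next
        case False
        hence "{A \<in> S. l \<le> A b} = {}" using le by (auto dest: mult_le_mono1[of l _ "w b"] order_trans)
        with False show ?thesis by (simp only: card.empty if_False)
      qed
      finally show "(\<Sum>A\<in>S. if l \<le> A b then 1 else 0) = (if l * w b \<le> n then wcount B w (n - l * w b) else 0)" .
    qed
    also have "\<dots> = (\<Sum>l\<in>{l \<in> {1..n}. l * w b \<le> n}. wcount B w (n - l * w b))"
      by (simp add: sum.If_cases Int_def)
    also have "\<dots> = (\<Sum>k\<in>{k \<in> {1..n}. w b dvd k}. wcount B w (n - k))"
      using pos[OF b] le_trans[OF div_le_dividend]
      by (intro sum.reindex_bij_witness[where i = "\<lambda>k. k div w b" and j = "\<lambda>l. l * w b"])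
        (auto simp: Suc_le_eq div_greater_zero_iff dvd_imp_le)
    also have "\<dots> = (\<Sum>k\<in>{1..n}. if w b dvd k then wcount B w (n - k) else 0)"
      by (simp add: sum.If_cases Int_def)
    finally show ?thesis .
  qed
  have "n * wcount B w n = (\<Sum>A\<in>S. n)" by (simp add: wcount_def S_def)
  also have "\<dots> = (\<Sum>A\<in>S. \<Sum>b\<in>B. A b * w b)" by (intro sum.cong) (auto simp: S_def)
  also have "\<dots> = (\<Sum>b\<in>B. \<Sum>A\<in>S. A b * w b)" by (rule sum.swap)
  also have "\<dots> = (\<Sum>b\<in>B. (\<Sum>k\<in>{1..n}. if w b dvd k then wcount B w (n - k) else 0) * w b)"
    by (intro sum.cong refl) (simp add: sum_distrib_right[symmetric] per_cell)
  also have "\<dots> = (\<Sum>b\<in>B. \<Sum>k\<in>{1..n}. (if w b dvd k then w b else 0) * wcount B w (n - k))"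
    unfolding sum_distrib_right by (intro sum.cong refl) simp
  also have "\<dots> = (\<Sum>k\<in>{1..n}. (\<Sum>b\<in>B. if w b dvd k then w b else 0) * wcount B w (n - k))"
    by (subst sum.swap) (simp add: sum_distrib_right)
  also have "\<dots> = (\<Sum>k\<in>{1..n}. (\<Sum>b\<in>{b \<in> B. w b dvd k}. w b) * wcount B w (n - k))"
    using fin by (simp add: sum.If_cases Int_def)
  finally show ?thesis .
qed

definition sigma2 :: "nat \<Rightarrow> nat" where
  "sigma2 k = (\<Sum>d | d dvd k. d\<^sup>2)"

text \<open>The cells of hook length \<open>d\<close> form an antidiagonal, which for
  \<open>d \<le> N\<close> has exactly \<open>d\<close> cells; each divisor \<open>d\<close> thus
  contributes \<open>d * d\<close>. The bound \<open>k \<le> N\<close> covers all divisors.\<close>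

lemma sum_antihook_dvd:
  assumes "0 < k" "k \<le> N"
  shows "(\<Sum>b\<in>{b \<in> grid N. antihook N b dvd k}. antihook N b) = sigma2 k"
proof -
  have card: "card {b \<in> grid N. antihook N b = d} = d" if "0 < d" "d \<le> N" for d
  proof -
    have "bij_betw (\<lambda>i. (N - i, N + 1 - (d - i))) {..<d} {b \<in> grid N. antihook N b = d}"
      by (rule bij_betw_byWitness[where f' = "\<lambda>(i, j). N - i"])
        (use that in \<open>auto simp: grid_def antihook_def\<close>)
    from bij_betw_same_card[OF this] show ?thesis by simp
  qed
  have fin: "finite {d. d dvd k}" using assms by simp
  have finb: "finite {b \<in> grid N. antihook N b dvd k}" by (simp add: grid_def)
  have "(\<Sum>b\<in>{b \<in> grid N. antihook N b dvd k}. antihook N b) =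
      (\<Sum>d | d dvd k. \<Sum>b\<in>{b \<in> {b \<in> grid N. antihook N b dvd k}. antihook N b = d}. antihook N b)"
    by (rule sum.group[symmetric, OF finb fin]) auto
  also have "\<dots> = (\<Sum>d | d dvd k. d\<^sup>2)"
  proof (rule sum.cong[OF refl])
    fix d assume "d \<in> {d. d dvd k}"
    hence d: "d dvd k" by simp
    hence "0 < d" "d \<le> N" using assms dvd_imp_le[OF d] by (auto intro: Nat.gr0I)
    have "(\<Sum>b\<in>{b \<in> {b \<in> grid N. antihook N b dvd k}. antihook N b = d}. antihook N b) =
        (\<Sum>b\<in>{b \<in> grid N. antihook N b = d}. d)"
      using d by (intro sum.cong) auto
    also have "\<dots> = d\<^sup>2" by (simp add: card \<open>0 < d\<close> \<open>d \<le> N\<close> power2_eq_square)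
    finally show "(\<Sum>b\<in>{b \<in> {b \<in> grid N. antihook N b dvd k}. antihook N b = d}. antihook N b) = d\<^sup>2" .
  qed
  finally show ?thesis by (simp add: sigma2_def)
qed

lemma pp_eq_wcount: "n \<le> N \<Longrightarrow> pp n = wcount (grid N) (antihook N) n"
  by (simp add: pp_eq_card_rpp card_rpp_grid)

text \<open>The square of side \<open>n\<close> serves for \<open>n\<close> and for all smaller
  \<open>n - k\<close> at once.\<close>

lemma pp_recurrence: "n * pp n = (\<Sum>k\<in>{1..n}. sigma2 k * pp (n - k))"
proof -
  have "n * pp n = n * wcount (grid n) (antihook n) n" by (simp add: pp_eq_wcount)
  also have "\<dots> = (\<Sum>k\<in>{1..n}. (\<Sum>b\<in>{b \<in> grid n. antihook n b dvd k}. antihook n b) *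
      wcount (grid n) (antihook n) (n - k))"
    by (rule wcount_recurrence) (auto simp: grid_def antihook_def)
  also have "\<dots> = (\<Sum>k\<in>{1..n}. sigma2 k * pp (n - k))"
    by (intro sum.cong refl) (simp add: sum_antihook_dvd pp_eq_wcount[symmetric])
  finally show ?thesis .
qed

lemma pp_0: "pp 0 = 1"
proof -
  have "{\<pi>. plane_partition 0 \<pi>} = {\<lambda>_ _. 0}"
    using plane_partition_support[of 0 _ 0] by (auto simp: fun_eq_iff plane_partition_def)
  thus ?thesis by (simp add: pp_def)
qed

section \<open>Evaluation of the recurrence\<close>

fun dot :: "int list \<Rightarrow> int list \<Rightarrow> int" where
  "dot (a # as) (b # bs) = a * b + dot as bs"
| "dot _ _ = 0"

fun sq_div :: "nat \<Rightarrow> int \<Rightarrow> int \<Rightarrow> int" where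
  "sq_div 0 d k = 0"
| "sq_div (Suc m) d k = (if k mod d = 0 then d * d else 0) + sq_div m (d + 1) k"

text \<open>\<open>k\<close> and \<open>i\<close> stand for the same number, as an integer for the
  arithmetic and as a natural bounding the recursion of \<open>sq_div\<close>.\<close>

fun sigma2_list :: "nat \<Rightarrow> int \<Rightarrow> nat \<Rightarrow> int list" where
  "sigma2_list 0 k i = []"
| "sigma2_list (Suc m) k i = sq_div i 1 k # sigma2_list m (k + 1) (Suc i)"

text \<open>With the newest value first, the convolution of the recurrence is a dot product that
  stops where \<open>ps\<close> ends.\<close>

fun pp_list :: "int list \<Rightarrow> nat \<Rightarrow> int \<Rightarrow> int list \<Rightarrow> int list" where
  "pp_list s 0 n ps = ps"
| "pp_list s (Suc m) n ps = pp_list s m (n + 1) (dot s ps div n # ps)"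

text \<open>The head values \<open>c\<close>, \<open>b\<close>, \<open>a\<close> are those at
  \<open>n + 1\<close>, \<open>n\<close>, \<open>n - 1\<close>. The test is an equivalence, so it
  also certifies the failures at odd \<open>n < 12\<close>.\<close>

fun check_list :: "int \<Rightarrow> int list \<Rightarrow> bool" where
  "check_list n (c # b # a # ps) \<longleftrightarrow>
     ((a * c < b * b) = (\<not> (n < 12 \<and> n mod 2 = 1))) \<and> check_list (n - 1) (b # a # ps)"
| "check_list n _ \<longleftrightarrow> True"

lemma dot_eq_sum: "length xs = length ys \<Longrightarrow> dot xs ys = (\<Sum>i<length xs. xs ! i * ys ! i)"
  by (induction xs ys rule: dot.induct) (simp_all add: sum.lessThan_Suc_shift del: sum.lessThan_Suc)

lemma dot_take: "dot xs ys = dot (take (length ys) xs) ys"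
  by (induction xs ys rule: dot.induct) auto

lemma sq_div_eq:
  "sq_div m (int d) (int k) = int (\<Sum>x\<in>{d..<d + m}. if x dvd k then x\<^sup>2 else 0)"
proof (induction m arbitrary: d)
  case (Suc m)
  have "(int k mod int d = 0) = (d dvd k)" by (simp add: dvd_eq_mod_eq_0 zmod_int[symmetric])
  moreover have "{d..<d + Suc m} = insert d {Suc d..<Suc d + m}" by auto
  ultimately show ?case using Suc.IH[of "Suc d"]
    by (simp add: power2_eq_square add.commute)
qed auto

lemma sq_div_sigma2: assumes "0 < k" shows "sq_div k 1 (int k) = int (sigma2 k)"
proof -
  have "d dvd k \<Longrightarrow> 1 \<le> d \<and> d < 1 + k" for d
    using assms dvd_imp_le[of d k] by (cases d) auto
  hence "{d. d dvd k} = {1..<1 + k} \<inter> {d. d dvd k}" by auto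
  hence "sigma2 k = (\<Sum>x\<in>{1..<1 + k} \<inter> {d. d dvd k}. x\<^sup>2)" by (simp only: sigma2_def)
  also have "\<dots> = (\<Sum>x\<in>{1..<1 + k}. if x dvd k then x\<^sup>2 else 0)"
    by (subst sum.inter_restrict) auto
  finally show ?thesis using sq_div_eq[of k 1 k] by simp
qed

lemma sigma2_list_eq:
  "0 < k \<Longrightarrow> sigma2_list m (int k) k = map (\<lambda>i. int (sigma2 i)) [k..<k + m]"
proof (induction m arbitrary: k)
  case (Suc m)
  have "[k..<k + Suc m] = k # [Suc k..<Suc k + m]" by (simp add: upt_rec)
  with Suc.IH[of "Suc k"] sq_div_sigma2[OF Suc.prems] show ?case
    by (simp add: add.commute)
qed auto

lemma pp_list_eq:
  "pp_list (map (\<lambda>i. int (sigma2 i)) [1..<M]) m (int n) (map (\<lambda>i. int (pp i)) (rev [0..<n]))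
     = map (\<lambda>i. int (pp i)) (rev [0..<n + m])" if "0 < n" "n + m \<le> M"
  using that
proof (induction m arbitrary: n)
  case (Suc m)
  let ?s = "map (\<lambda>i. int (sigma2 i)) [1..<M]" and ?ps = "map (\<lambda>i. int (pp i)) (rev [0..<n])"
  have "dot ?s ?ps = (\<Sum>i<n. int (sigma2 (Suc i)) * int (pp (n - Suc i)))"
  proof -
    have "length ?ps = n" "n \<le> length ?s" using Suc.prems by auto
    hence "dot ?s ?ps = (\<Sum>i<n. take n ?s ! i * ?ps ! i)"
      using dot_take[of ?s ?ps] dot_eq_sum[of "take n ?s" ?ps] by simp
    also have "\<dots> = (\<Sum>i<n. int (sigma2 (Suc i)) * int (pp (n - Suc i)))"
    proof (rule sum.cong[OF refl])
      fix i assume "i \<in> {..<n}"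
      hence "take n ?s ! i = int (sigma2 (Suc i))" "?ps ! i = int (pp (n - Suc i))"
        using Suc.prems by (simp_all add: rev_nth)
      thus "take n ?s ! i * ?ps ! i = int (sigma2 (Suc i)) * int (pp (n - Suc i))" by simp
    qed
    finally show ?thesis .
  qed
  also have "\<dots> = int (\<Sum>k\<in>{1..n}. sigma2 k * pp (n - k))"
    by (simp only: One_nat_def sum.atLeast1_atMost_eq of_nat_sum of_nat_mult)
  also have "\<dots> = int n * int (pp n)" by (simp only: pp_recurrence[symmetric] of_nat_mult)
  finally have "dot ?s ?ps div int n = int (pp n)" using Suc.prems by simp
  moreover have "rev [0..<Suc n] = n # rev [0..<n]" by simp
  ultimately have "dot ?s ?ps div int n # ?ps = map (\<lambda>i. int (pp i)) (rev [0..<Suc n])" by simp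
  moreover have "int n + 1 = int (Suc n)" by simp
  ultimately show ?case using Suc.IH[of "Suc n"] Suc.prems by (simp only: pp_list.simps) simp
qed auto

lemma check_list_eq:
  assumes "check_list (int N) (map (\<lambda>i. int (pp i)) (rev [0..<N + 2]))" "0 < n" "n \<le> N"
  shows "(pp (n - 1) * pp (n + 1) < (pp n)\<^sup>2) \<longleftrightarrow> \<not> (n < 12 \<and> odd n)"
  using assms
proof (induction N)
  case (Suc N)
  have "map (\<lambda>i. int (pp i)) (rev [0..<Suc N + 2]) =
      int (pp (Suc (Suc N))) # int (pp (Suc N)) # int (pp N) # map (\<lambda>i. int (pp i)) (rev [0..<N])" by simp
  with Suc.prems(1) have "((int (pp N) * int (pp (Suc (Suc N))) < int (pp (Suc N)) * int (pp (Suc N))) =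
        (\<not> (int (Suc N) < 12 \<and> int (Suc N) mod 2 = 1)))"
    and ck: "check_list (int (Suc N) - 1) (int (pp (Suc N)) # int (pp N) # map (\<lambda>i. int (pp i)) (rev [0..<N]))"
    by (simp_all only: check_list.simps)
  moreover have "int (Suc N) mod 2 = 1 \<longleftrightarrow> odd (Suc N)"
    by presburger
  ultimately have "(pp N * pp (Suc (Suc N)) < (pp (Suc N))\<^sup>2) = (\<not> (Suc N < 12 \<and> odd (Suc N)))"
    by (simp only: power2_eq_square of_nat_mult[symmetric] of_nat_less_iff) linarith
  moreover have "check_list (int N) (map (\<lambda>i. int (pp i)) (rev [0..<N + 2]))"
    using ck by simp
  ultimately show ?case using Suc by (cases "n = Suc N") auto
qed auto

lemma pp_log_concave_upto_303:
  assumes "0 < n" "n \<le> 303"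
  shows "(pp (n - 1) * pp (n + 1) < (pp n)\<^sup>2) \<longleftrightarrow> \<not> (n < 12 \<and> odd n)"
proof -
  \<comment> \<open>304 steps from the list \<open>[1]\<close> reach \<open>pp 304\<close>, which
    the test at \<open>n = 303\<close> reads.\<close>
  have "sigma2_list 304 1 1 = map (\<lambda>i. int (sigma2 i)) [1..<305]"
    using sigma2_list_eq[of 1 304] by (simp del: upt_rec_numeral)
  hence "map (\<lambda>i. int (pp i)) (rev [0..<305]) = pp_list (sigma2_list 304 1 1) 304 1 [1]"
    using pp_list_eq[of 1 304 305] by (simp add: pp_0 del: upt_rec_numeral)
  moreover have "check_list 303 (pp_list (sigma2_list 304 1 1) 304 1 [1])" by code_simp
  ultimately have "check_list (int 303) (map (\<lambda>i. int (pp i)) (rev [0..<303 + 2]))"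
    by (simp del: upt_rec_numeral)
  thus ?thesis using assms by (rule check_list_eq)
qed

section \<open>The generating function on a circle\<close>

text \<open>Termwise differentiation turns the coefficients \<open>n ^ k\<close> into
  \<open>Suc n ^ Suc k\<close>, which gives the induction step.\<close>

lemma summable_pow_geometric:
  fixes x :: real
  assumes "\<bar>x\<bar> < 1"
  shows "summable (\<lambda>n. real n ^ k * x ^ n)"
  using assms
proof (induction k arbitrary: x)
  case 0
  thus ?case by (simp add: summable_geometric)
next
  case (Suc k)
  have "summable (\<lambda>n. diffs (\<lambda>n. real n ^ k) n * x ^ n)"
    by (rule termdiff_converges[of x 1]) (use Suc in auto)
  hence "summable (\<lambda>n. x * (real (Suc n) ^ Suc k * x ^ n))"
    by (intro summable_mult) (simp add: diffs_def)
  hence "summable (\<lambda>n. real (Suc n) ^ Suc k * x ^ Suc n)"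
    by (simp add: mult_ac)
  thus ?case by (subst (asm) summable_Suc_iff)
qed

text \<open>Coefficients of the logarithm of MacMahon's product: expanding
  \<open>- k * ln (1 - z ^ k)\<close> and collecting \<open>z ^ j\<close> gives the sum of
  \<open>k * k / j\<close> over the divisors \<open>k\<close> of \<open>j\<close>.\<close>

definition log_coeff :: "nat \<Rightarrow> real" where
  "log_coeff j = real (sigma2 j) / real j"

lemma sigma2_bounds: "0 < j \<Longrightarrow> j\<^sup>2 \<le> sigma2 j" "sigma2 j \<le> j ^ 3"
proof -
  show "j\<^sup>2 \<le> sigma2 j" if "0 < j"
    unfolding sigma2_def using that by (intro member_le_sum) auto
  show "sigma2 j \<le> j ^ 3"
  proof (cases "j = 0")
    case False
    hence "{d. d dvd j} \<subseteq> {1..j}" using dvd_imp_le[of _ j] by (auto simp: Suc_le_eq intro!: Nat.gr0I)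
    hence "sigma2 j \<le> (\<Sum>d\<in>{1..j}. d\<^sup>2)" unfolding sigma2_def by (intro sum_mono2) auto
    also have "\<dots> \<le> (\<Sum>d\<in>{1..j}. j\<^sup>2)" by (intro sum_mono) (auto intro: power_mono)
    finally show ?thesis by (simp add: power2_eq_square power3_eq_cube)
  qed (simp add: sigma2_def)
qed

lemma log_coeff_0 [simp]: "log_coeff 0 = 0"
  by (simp add: log_coeff_def)

lemma log_coeff_bounds: "real j \<le> log_coeff j" "log_coeff j \<le> real j ^ 2" "0 \<le> log_coeff j"
proof -
  show "real j \<le> log_coeff j"
  proof (cases "j = 0")
    case False
    have "real (j\<^sup>2) \<le> real (sigma2 j)" using sigma2_bounds(1)[of j] False by (intro of_nat_mono) auto
    thus ?thesis using False by (simp add: log_coeff_def field_simps power2_eq_square)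
  qed auto
  show "log_coeff j \<le> real j ^ 2"
  proof (cases "j = 0")
    case False
    have "real (sigma2 j) \<le> real (j ^ 3)" using sigma2_bounds(2)[of j] by (intro of_nat_mono) auto
    thus ?thesis using False by (simp add: log_coeff_def field_simps power2_eq_square power3_eq_cube)
  qed auto
  show "0 \<le> log_coeff j" by (simp add: log_coeff_def)
qed

lemma summable_log_coeff:
  assumes "0 \<le> q" "q < 1" "\<And>j. \<bar>f j\<bar> \<le> C * real j ^ k"
  shows "summable (\<lambda>j. log_coeff j * q ^ j * f j)"
proof (rule summable_comparison_test')
  show "summable (\<lambda>j. C * (real j ^ (k + 2) * q ^ j))"
    using assms by (intro summable_mult summable_pow_geometric) auto
  fix j :: nat
  have "norm (log_coeff j * q ^ j * f j) = (log_coeff j * q ^ j) * \<bar>f j\<bar>"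
    using assms log_coeff_bounds(3)[of j] by (simp add: abs_mult)
  also have "\<dots> \<le> (real j ^ 2 * q ^ j) * (C * real j ^ k)"
    using assms log_coeff_bounds[of j] by (intro mult_mono mult_right_mono) auto
  finally show "norm (log_coeff j * q ^ j * f j) \<le> C * (real j ^ (k + 2) * q ^ j)"
    by (simp add: power_add power2_eq_square mult_ac)
qed

definition log_fps :: "complex fps" where
  "log_fps = Abs_fps (\<lambda>j. of_real (log_coeff j))"

lemma conv_radius_log_fps: "fps_conv_radius log_fps \<ge> 1"
proof -
  have "summable (\<lambda>n. fps_nth log_fps n * of_real r ^ n)" if "0 < r" "r < 1" for r :: real
  proof -
    have "summable (\<lambda>j. log_coeff j * r ^ j * 1)"
      by (rule summable_log_coeff[where C = 1 and k = 0]) (use that in auto)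
    hence "summable (\<lambda>j. complex_of_real (log_coeff j * r ^ j))"
      by (subst summable_of_real_iff) simp
    thus ?thesis by (simp add: log_fps_def)
  qed
  thus ?thesis unfolding fps_conv_radius_def one_ereal_def
    by (intro conv_radius_geI_ex') auto
qed

definition pp_gf :: "complex \<Rightarrow> complex" where
  "pp_gf z = exp (eval_fps log_fps z)"

lemma eball_log_fps: "ball 0 1 \<subseteq> eball 0 (fps_conv_radius log_fps)"
  using conv_radius_log_fps by (intro ball_eball_mono) (simp add: one_ereal_def)

lemma holomorphic_pp_gf: "pp_gf holomorphic_on ball 0 1"
  unfolding pp_gf_def by (intro holomorphic_intros eball_log_fps)

text \<open>The derivative of the exponential is \<open>L' * pp_gf\<close>, and \<open>L'\<close>
  has coefficients \<open>sigma2 (Suc i)\<close>. Comparing coefficients yields the recurrence of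
  \<open>pp\<close>, which together with the value 1 at 0 determines the series.\<close>

lemma pp_gf_expansion: "pp_gf has_fps_expansion Abs_fps (\<lambda>n. of_nat (pp n))"
proof -
  define P where "P = fps_expansion pp_gf 0"
  have P: "pp_gf has_fps_expansion P"
    unfolding P_def by (rule has_fps_expansion_fps_expansion[OF _ _ holomorphic_pp_gf]) auto
  have rad: "fps_conv_radius log_fps > 0"
    using conv_radius_log_fps by (rule less_le_trans[rotated]) simp
  have dP: "deriv pp_gf has_fps_expansion fps_deriv P"
    by (rule has_fps_expansion_deriv[OF P])
  have LP: "(\<lambda>z. eval_fps (fps_deriv log_fps) z * pp_gf z) has_fps_expansion fps_deriv log_fps * P"
    using rad fps_conv_radius_deriv[of log_fps]
    by (intro has_fps_expansion_mult eval_fps_has_fps_expansion P) (rule less_le_trans)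
  have ev: "eventually (\<lambda>z. deriv pp_gf z = eval_fps (fps_deriv log_fps) z * pp_gf z) (nhds 0)"
  proof -
    have "eventually (\<lambda>z. z \<in> ball (0::complex) 1) (nhds 0)"
      by (rule eventually_nhds_in_open) auto
    thus ?thesis
    proof eventually_elim
      case (elim z)
      hence "ereal (norm z) < fps_conv_radius log_fps" using eball_log_fps by (metis dist_0_norm in_eball_iff subsetD)
      from has_field_derivative_eval_fps[OF this]
      have "(pp_gf has_field_derivative exp (eval_fps log_fps z) * eval_fps (fps_deriv log_fps) z) (at z)"
        unfolding pp_gf_def by (rule DERIV_chain2[OF DERIV_exp])
      thus ?case by (simp add: DERIV_imp_deriv pp_gf_def mult.commute)
    qed
  qed
  have "fps_deriv P = fps_deriv log_fps * P"
    by (rule fps_expansion_unique_complex[OF dP])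
      (rule iffD2[OF has_fps_expansion_cong[OF ev refl] LP])
  hence rec: "of_nat (Suc m) * fps_nth P (Suc m) = (\<Sum>i\<le>m. of_nat (sigma2 (Suc i)) * fps_nth P (m - i))" for m
  proof -
    assume *: "fps_deriv P = fps_deriv log_fps * P"
    have "of_nat (Suc m) * fps_nth P (Suc m) = fps_nth (fps_deriv P) m" by simp
    also have "\<dots> = (\<Sum>i\<le>m. fps_nth (fps_deriv log_fps) i * fps_nth P (m - i))"
      unfolding * by (simp add: fps_mult_nth atLeast0AtMost)
    also have "\<dots> = (\<Sum>i\<le>m. of_nat (sigma2 (Suc i)) * fps_nth P (m - i))"
    proof (rule sum.cong[OF refl])
      fix i
      have "complex_of_real (log_coeff (Suc i)) = of_nat (sigma2 (Suc i)) / of_nat (Suc i)"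
        by (simp only: log_coeff_def of_real_divide of_real_of_nat_eq)
      hence "fps_nth (fps_deriv log_fps) i = of_nat (sigma2 (Suc i))"
        by (simp add: log_fps_def del: of_nat_Suc)
      thus "fps_nth (fps_deriv log_fps) i * fps_nth P (m - i) = of_nat (sigma2 (Suc i)) * fps_nth P (m - i)"
        by simp
    qed
    finally show ?thesis .
  qed
  have "fps_nth P n = of_nat (pp n)" for n
  proof (induction n rule: less_induct)
    case (less n)
    show ?case
    proof (cases n)
      case 0
      have "fps_nth P 0 = pp_gf 0" using fps_nth_fps_expansion[OF P, of 0] by simp
      thus ?thesis using 0 by (simp add: pp_0 pp_gf_def eval_fps_at_0 log_fps_def)
    next
      case (Suc m)
      have "of_nat (Suc m) * fps_nth P (Suc m) = (\<Sum>i\<le>m. of_nat (sigma2 (Suc i)) * of_nat (pp (m - i)))"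
        unfolding rec using less Suc by (intro sum.cong refl) auto
      also have "\<dots> = of_nat (\<Sum>i<Suc m. sigma2 (Suc i) * pp (Suc m - Suc i))"
        by (simp add: lessThan_Suc_atMost)
      also have "(\<Sum>i<Suc m. sigma2 (Suc i) * pp (Suc m - Suc i)) = (\<Sum>k\<in>{1..Suc m}. sigma2 k * pp (Suc m - k))"
        by (simp only: One_nat_def sum.atLeast1_atMost_eq)
      also have "\<dots> = Suc m * pp (Suc m)" by (rule pp_recurrence[symmetric])
      finally have "complex_of_nat (Suc m) * fps_nth P (Suc m) = of_nat (Suc m) * of_nat (pp (Suc m))"
        by (simp only: of_nat_mult)
      thus ?thesis using Suc by (simp del: of_nat_Suc)
    qed
  qed
  hence "P = Abs_fps (\<lambda>n. of_nat (pp n))" by (simp add: fps_eq_iff)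
  with P show ?thesis by simp
qed

lemma pp_integral:
  assumes "0 < q" "q < 1"
  shows "((\<lambda>t. pp_gf (of_real q * cis t) * cis (- (real n * t))) has_integral
           of_real (2 * pi * (real (pp n) * q ^ n))) {0..2 * pi}"
proof -
  have "cball 0 q \<subseteq> ball (0::complex) 1" using assms by auto
  hence "((\<lambda>u. pp_gf u / (u - 0) ^ Suc n) has_contour_integral
      2 * pi * \<i> / fact n * (deriv ^^ n) pp_gf 0) (circlepath 0 q)"
    using assms holomorphic_on_imp_continuous_on[OF holomorphic_pp_gf]
    by (intro Cauchy_has_contour_integral_higher_derivative_circlepath)
      (auto intro: holomorphic_on_subset[OF holomorphic_pp_gf] continuous_on_subset)
  also have "2 * pi * \<i> / fact n * (deriv ^^ n) pp_gf 0 = 2 * pi * \<i> * of_nat (pp n)"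
    using fps_nth_fps_expansion[OF pp_gf_expansion, of n] by (simp add: field_simps)
  finally have "((\<lambda>t. pp_gf (0 + q * cis t) / (0 + q * cis t - 0) ^ Suc n * q * \<i> * cis t)
       has_integral (2 * pi * \<i> * of_nat (pp n))) {0..2 * pi}"
    unfolding circlepath_def by (rule iffD1[OF has_contour_integral_part_circlepath_iff, rotated]) simp
  hence "((\<lambda>t. of_real q ^ n / \<i> * (pp_gf (0 + q * cis t) / (0 + q * cis t - 0) ^ Suc n * q * \<i> * cis t))
       has_integral (of_real q ^ n / \<i> * (2 * pi * \<i> * of_nat (pp n)))) {0..2 * pi}"
    by (rule has_integral_mult_right)
  moreover have "of_real q ^ n / \<i> * (pp_gf (0 + q * cis t) / (0 + q * cis t - 0) ^ Suc n * q * \<i> * cis t)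
     = pp_gf (of_real q * cis t) * cis (- (real n * t))" for t
  proof -
    have "cis (- (real n * t)) = 1 / cis t ^ n"
      by (simp add: Complex.DeMoivre cis_divide flip: cis_zero)
    thus ?thesis using assms by (simp add: field_simps)
  qed
  ultimately show ?thesis by (simp add: mult_ac)
qed

section \<open>Modulus and argument on the circle\<close>

text \<open>\<open>exp (- decay q t)\<close> is the modulus of \<open>pp_gf\<close> at angle
  \<open>t\<close> relative to its value at angle 0; \<open>phase\<close> is the argument after the
  factor \<open>cis (- (real n * t))\<close> is included.\<close>

definition decay :: "real \<Rightarrow> real \<Rightarrow> real" where
  "decay q t = (\<Sum>j. log_coeff j * q ^ j * (1 - cos (real j * t)))"

definition phase :: "real \<Rightarrow> nat \<Rightarrow> real \<Rightarrow> real" where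
  "phase q n t = (\<Sum>j. log_coeff j * q ^ j * sin (real j * t)) - real n * t"

lemma pp_gf_polar:
  assumes "0 < q" "q < 1"
  shows "Re (pp_gf (of_real q * cis t) * cis (- (real n * t)))
    = exp (\<Sum>j. log_coeff j * q ^ j) * (exp (- decay q t) * cos (phase q n t))"
proof -
  let ?L = "eval_fps log_fps (of_real q * cis t)"
  have tm: "fps_nth log_fps j * (of_real q * cis t) ^ j = of_real (log_coeff j * q ^ j) * cis (real j * t)" for j
    by (simp add: log_fps_def power_mult_distrib Complex.DeMoivre)
  have norm: "ereal (norm (of_real q * cis t)) < fps_conv_radius log_fps"
    using assms conv_radius_log_fps by (intro less_le_trans[OF _ conv_radius_log_fps]) (simp add: norm_mult one_ereal_def)
  have sums: "(\<lambda>j. of_real (log_coeff j * q ^ j) * cis (real j * t)) sums ?L"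
    using sums_eval_fps[OF norm] unfolding tm .
  have s: "summable (\<lambda>j. log_coeff j * q ^ j * 1)"
    by (rule summable_log_coeff[where C = 1 and k = 0]) (use assms in auto)
  have c: "summable (\<lambda>j. log_coeff j * q ^ j * cos (real j * t))"
    by (rule summable_log_coeff[where C = 1 and k = 0]) (use assms in auto)
  have "(\<lambda>j. log_coeff j * q ^ j * cos (real j * t)) sums Re ?L"
    using sums_Re[OF sums] by simp
  hence "Re ?L = (\<Sum>j. log_coeff j * q ^ j) + - decay q t"
    unfolding decay_def right_diff_distrib using suminf_diff[OF s c] by (simp add: sums_iff)
  moreover have "(\<lambda>j. log_coeff j * q ^ j * sin (real j * t)) sums Im ?L"
    using sums_Im[OF sums] by simp
  hence "Im ?L - real n * t = phase q n t" by (simp add: phase_def sums_iff)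
  moreover have "pp_gf (of_real q * cis t) * cis (- (real n * t)) =
      of_real (exp (Re ?L)) * cis (Im ?L - real n * t)"
    by (simp add: pp_gf_def exp_eq_polar cis_mult)
  ultimately show ?thesis
    using exp_add[of "\<Sum>j. log_coeff j * q ^ j" "- decay q t"] by simp
qed

text \<open>Continuity of the product is inherited from the holomorphic \<open>pp_gf\<close>, which
  avoids treating the two series separately.\<close>

lemma continuous_on_pp_gf_circle:
  assumes "0 < q" "q < 1"
  shows "continuous_on S (\<lambda>t. exp (- decay q t) * cos (phase q n t))"
proof -
  have "continuous_on S (\<lambda>t. pp_gf (of_real q * cis t))"
    by (rule continuous_on_compose2[OF holomorphic_on_imp_continuous_on[OF holomorphic_pp_gf]])
      (use assms in \<open>auto intro!: continuous_intros simp: norm_mult\<close>)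
  hence "continuous_on S (\<lambda>t. Re (pp_gf (of_real q * cis t) * cis (- (real n * t))) / exp (\<Sum>j. log_coeff j * q ^ j))"
    by (intro continuous_intros) auto
  thus ?thesis unfolding pp_gf_polar[OF assms] by simp
qed

text \<open>Positivity of the integral says that \<open>P m = pp m * q ^ m\<close> is strictly concave at \<open>n\<close>;
  log-concavity of \<open>P\<close>, hence of \<open>pp\<close>, follows by AM-GM.\<close>

lemma log_concave_of_integral_pos:
  assumes q: "0 < q" "q < 1" and n: "0 < n"
    and pos: "0 < integral {0..pi} (\<lambda>t. exp (- decay q t) * cos (phase q n t) * (1 - cos t))"
  shows "pp (n - 1) * pp (n + 1) < (pp n)\<^sup>2"
proof -
  define K where "K = exp (\<Sum>j. log_coeff j * q ^ j)"
  define P where "P m = real (pp m) * q ^ m" for m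
  define h where "h t = exp (- decay q t) * cos (phase q n t) * (1 - cos t)" for t
  have cont: "continuous_on S h" for S
    unfolding h_def by (intro continuous_intros continuous_on_pp_gf_circle q)
  \<comment> \<open>Conjugation symmetry: \<open>t\<close> to \<open>2 * pi - t\<close> negates the
    phase up to a multiple of \<open>2 * pi\<close>, so the full circle gives twice the half
    circle.\<close>
  have refl: "h (2 * pi - t) = h t" for t
  proof -
    have trig: "cos (real j * (2 * pi - t)) = cos (real j * t)"
      "sin (real j * (2 * pi - t)) = - sin (real j * t)" for j :: nat
      using cos_2npi[of j] sin_2npi[of j]
      by (simp_all add: right_diff_distrib cos_diff sin_diff mult.assoc mult.left_commute[of _ 2])
    have "(\<Sum>j. log_coeff j * q ^ j * - sin (real j * t)) = - (\<Sum>j. log_coeff j * q ^ j * sin (real j * t))"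
      using suminf_minus[OF summable_log_coeff[where f = "\<lambda>j. sin (real j * t)" and C = 1 and k = 0 and q = q]] q
      by simp
    hence ph: "phase q n (2 * pi - t) = - phase q n t - 2 * pi * real n"
      unfolding phase_def trig by (simp add: algebra_simps)
    have "cos (phase q n (2 * pi - t)) = cos (phase q n t)"
      unfolding ph using cos_2npi[of n] sin_2npi[of n] by (simp add: cos_diff mult_ac)
    moreover have "decay q (2 * pi - t) = decay q t" unfolding decay_def trig ..
    moreover have "cos (2 * pi - t) = cos t" by simp
    ultimately show ?thesis by (simp add: h_def)
  qed
  have "(h has_integral integral {0..pi} h) {0..pi}"
    by (intro integrable_integral integrable_continuous_real cont)
  moreover from this have "((\<lambda>t. h (- t)) has_integral integral {0..pi} h) {- pi..0}"
    using has_integral_reflect_real[of h "integral {0..pi} h" pi 0] by simp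
  hence "((\<lambda>t. h (- (t - 2 * pi))) has_integral integral {0..pi} h) {pi..2 * pi}"
    by (drule_tac has_integral_shift_real_ivl[where c = "- (2 * pi)"]) simp
  hence "(h has_integral integral {0..pi} h) {pi..2 * pi}" by (simp add: refl)
  ultimately have h2: "(h has_integral (integral {0..pi} h + integral {0..pi} h)) {0..2 * pi}"
    by (rule has_integral_combine[rotated 2]) auto
  obtain m where m: "n = Suc m" using n by (cases n) auto
  have I: "((\<lambda>t. Re (pp_gf (of_real q * cis t) * cis (- (real k * t)))) has_integral (2 * pi * P k)) {0..2 * pi}" for k
    using has_integral_Re[OF pp_integral[OF q, of k]] by (simp add: P_def)
  have "((\<lambda>t. 2 * Re (pp_gf (of_real q * cis t) * cis (- (real n * t)))
        - Re (pp_gf (of_real q * cis t) * cis (- (real (n - 1) * t)))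
        - Re (pp_gf (of_real q * cis t) * cis (- (real (n + 1) * t))))
      has_integral (2 * (2 * pi * P n) - 2 * pi * P (n - 1) - 2 * pi * P (n + 1))) {0..2 * pi}"
    by (intro has_integral_diff has_integral_mult_right I)
  moreover have "2 * Re (pp_gf (of_real q * cis t) * cis (- (real n * t)))
        - Re (pp_gf (of_real q * cis t) * cis (- (real (n - 1) * t)))
        - Re (pp_gf (of_real q * cis t) * cis (- (real (n + 1) * t))) = 2 * K * h t" for t
  proof -
    let ?G = "pp_gf (of_real q * cis t) * cis (- (real n * t))"
    \<comment> \<open>Shifting \<open>n\<close> by one multiplies the integrand by
      \<open>cis t\<close> or \<open>cis (- t)\<close>, so the second difference produces the factor
      \<open>2 - cis t - cis (- t)\<close>.\<close>
    have "cis (- (real (n - 1) * t)) = cis (- (real n * t)) * cis t"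
         "cis (- (real (n + 1) * t)) = cis (- (real n * t)) * cis (- t)"
      unfolding cis_mult by (rule arg_cong[where f = cis]; simp add: m algebra_simps)+
    hence "2 * Re ?G - Re (pp_gf (of_real q * cis t) * cis (- (real (n - 1) * t)))
        - Re (pp_gf (of_real q * cis t) * cis (- (real (n + 1) * t)))
      = Re (?G * (2 - (cis t + cis (- t))))" by (simp only: minus_complex.sel times_complex.sel) (simp add: algebra_simps)
    also have "2 - (cis t + cis (- t)) = of_real (2 * (1 - cos t))" by (simp add: complex_eq_iff)
    also have "Re (?G * of_real (2 * (1 - cos t))) = Re ?G * (2 * (1 - cos t))"
      by simp
    finally show ?thesis unfolding pp_gf_polar[OF q] by (simp add: K_def h_def)
  qed
  ultimately have "((\<lambda>t. 2 * K * h t) has_integral (2 * (2 * pi * P n) - 2 * pi * P (n - 1) - 2 * pi * P (n + 1))) {0..2 * pi}"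
    by simp
  moreover have "((\<lambda>t. 2 * K * h t) has_integral (2 * K * (integral {0..pi} h + integral {0..pi} h))) {0..2 * pi}"
    by (intro has_integral_mult_right h2)
  ultimately have "2 * (2 * pi * P n) - 2 * pi * P (n - 1) - 2 * pi * P (n + 1) = 2 * K * (integral {0..pi} h + integral {0..pi} h)"
    by (rule has_integral_unique)
  moreover have "0 < K" "0 < integral {0..pi} h" using pos by (simp_all add: K_def h_def[abs_def])
  ultimately have "0 < 2 * pi * (2 * P n - (P (n - 1) + P (n + 1)))" by (simp add: algebra_simps)
  hence lt: "P (n - 1) + P (n + 1) < 2 * P n" by (simp add: zero_less_mult_iff)
  have nn: "0 \<le> P k" for k using q by (simp add: P_def)
  have "4 * (P (n - 1) * P (n + 1)) \<le> (P (n - 1) + P (n + 1))\<^sup>2"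
    using zero_le_power2[of "P (n - 1) - P (n + 1)"] by (simp add: power2_eq_square algebra_simps)
  also have "\<dots> < (2 * P n)\<^sup>2" using lt nn by (intro power_strict_mono) auto
  finally have "P (n - 1) * P (n + 1) < (P n)\<^sup>2" by (simp add: power2_eq_square)
  hence "real (pp (n - 1)) * real (pp (n + 1)) * (q ^ n)\<^sup>2 < (real (pp n))\<^sup>2 * (q ^ n)\<^sup>2"
    unfolding P_def m by (simp add: power2_eq_square mult_ac)
  hence "real (pp (n - 1) * pp (n + 1)) < real ((pp n)\<^sup>2)" using q by simp
  thus ?thesis by (simp only: of_nat_less_iff)
qed

section \<open>Moments of the coefficients\<close>

text \<open>The polylogarithm of order \<open>- a\<close>, except that for \<open>a = 0\<close> the
  term \<open>k = 0\<close> contributes 1.\<close>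

definition pow_sum :: "nat \<Rightarrow> real \<Rightarrow> real" where
  "pow_sum a q = (\<Sum>k. real k ^ a * q ^ k)"

text \<open>Index shift and binomial expansion; \<open>0 < a\<close> makes the term at
  \<open>k = 0\<close> vanish.\<close>

lemma pow_sum_rec:
  assumes "0 < q" "q < 1" "0 < a"
  shows "pow_sum a q = q * (\<Sum>i\<le>a. real (a choose i) * pow_sum i q)"
proof -
  have s: "summable (\<lambda>k. real k ^ i * q ^ k)" for i
    using assms by (intro summable_pow_geometric) auto
  have "pow_sum a q = (\<Sum>k. real (Suc k) ^ a * q ^ Suc k)"
    unfolding pow_sum_def using suminf_split_head[OF s[of a]] assms by simp
  also have "\<dots> = (\<Sum>k. q * (\<Sum>i\<le>a. real (a choose i) * (real k ^ i * q ^ k)))"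
  proof (intro suminf_cong)
    fix k
    have "real (Suc k) ^ a = (\<Sum>i\<le>a. real (a choose i) * real k ^ i)"
      using binomial_ring[of "real k" 1 a] by (simp add: add.commute)
    thus "real (Suc k) ^ a * q ^ Suc k = q * (\<Sum>i\<le>a. real (a choose i) * (real k ^ i * q ^ k))"
      by (simp add: sum_distrib_left sum_distrib_right mult_ac)
  qed
  also have "\<dots> = q * (\<Sum>i\<le>a. real (a choose i) * pow_sum i q)"
    unfolding pow_sum_def
    by (subst suminf_mult, (intro summable_sum summable_mult s),
        subst suminf_sum, (intro summable_mult s), subst suminf_mult, rule s, rule refl)
  finally show ?thesis .
qed

text \<open>The numerators are Eulerian polynomials. They are palindromic, hence polynomials in
  \<open>Y\<close>, which equals \<open>q + 1 / q - 2\<close>; for even \<open>a\<close> a square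
  root remains, so \<open>pow_sum 2\<close> appears squared.\<close>

lemma pow_sum_closed_forms:
  fixes q :: real
  assumes q: "0 < q" "q < 1"
  defines "Y \<equiv> (1 - q)\<^sup>2 / q"
  shows "(pow_sum 2 q)\<^sup>2 = (Y + 4) / Y ^ 3" "pow_sum 3 q = (Y + 6) / Y\<^sup>2"
    "pow_sum 5 q = (Y\<^sup>2 + 30 * Y + 120) / Y ^ 3"
proof -
  define d where "d = 1 - q"
  have d: "0 < d" "q = 1 - d" using q by (auto simp: d_def)
  have s0: "pow_sum 0 q = 1 / d"
    using q by (simp add: pow_sum_def suminf_geometric d_def)
  have rec: "d * pow_sum a q = q * (\<Sum>i<a. real (a choose i) * pow_sum i q)" if "0 < a" for a
  proof -
    have "pow_sum a q = q * ((\<Sum>i<a. real (a choose i) * pow_sum i q) + pow_sum a q)"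
      using pow_sum_rec[OF q that] by (simp add: lessThan_Suc_atMost[symmetric])
    thus ?thesis by (simp add: d_def algebra_simps)
  qed
  have "d * pow_sum 1 q = q * pow_sum 0 q" using rec[of 1] by simp
  hence "pow_sum 1 q = q * pow_sum 0 q / d" using d(1) by (simp add: field_simps)
  hence s1: "pow_sum (Suc 0) q = q / d ^ 2" using d(1) by (simp add: s0 power2_eq_square)
  have "d * pow_sum 2 q = q * (pow_sum 0 q + 2 * pow_sum 1 q)"
    using rec[of 2] by (simp add: lessThan_nat_numeral lessThan_Suc numeral_eq_Suc)
  hence "pow_sum 2 q = q * (pow_sum 0 q + 2 * pow_sum 1 q) / d"
    using d(1) by (simp add: field_simps)
  also have "\<dots> = q * (d + 2 * q) / d ^ 3"
    unfolding One_nat_def s0 s1 using d(1) by (simp add: field_simps eval_nat_numeral)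
  also have "d + 2 * q = 1 + q" by (simp add: d(2))
  finally have s2: "pow_sum 2 q = q * (1 + q) / d ^ 3" .
  have "d * pow_sum 3 q = q * (pow_sum 0 q + 3 * pow_sum 1 q + 3 * pow_sum 2 q)"
    using rec[of 3] by (simp add: lessThan_nat_numeral lessThan_Suc numeral_eq_Suc)
  hence "pow_sum 3 q = q * (pow_sum 0 q + 3 * pow_sum 1 q + 3 * pow_sum 2 q) / d"
    using d(1) by (simp add: field_simps)
  also have "\<dots> = q * (d ^ 2 + 3 * q * d + 3 * q * (1 + q)) / d ^ 4"
    unfolding One_nat_def s0 s1 s2 using d(1) by (simp add: field_simps eval_nat_numeral)
  also have "d ^ 2 + 3 * q * d + 3 * q * (1 + q) = 1 + 4 * q + q ^ 2"
    by (simp add: d(2) power2_eq_square algebra_simps)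
  finally have s3: "pow_sum 3 q = q * (1 + 4 * q + q ^ 2) / d ^ 4" .
  have "d * pow_sum 4 q = q * (pow_sum 0 q + 4 * pow_sum 1 q + 6 * pow_sum 2 q + 4 * pow_sum 3 q)"
    using rec[of 4] by (simp add: lessThan_nat_numeral lessThan_Suc numeral_eq_Suc)
  hence "pow_sum 4 q = q * (pow_sum 0 q + 4 * pow_sum 1 q + 6 * pow_sum 2 q + 4 * pow_sum 3 q) / d"
    using d(1) by (simp add: field_simps)
  also have "\<dots> = q * (d ^ 3 + 4 * q * d ^ 2 + 6 * q * (1 + q) * d + 4 * q * (1 + 4 * q + q ^ 2)) / d ^ 5"
    unfolding One_nat_def s0 s1 s2 s3 using d(1) by (simp add: field_simps eval_nat_numeral)
  also have "d ^ 3 + 4 * q * d ^ 2 + 6 * q * (1 + q) * d + 4 * q * (1 + 4 * q + q ^ 2) = 1 + 11 * q + 11 * q ^ 2 + q ^ 3"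
    by (simp add: d(2) eval_nat_numeral algebra_simps)
  finally have s4: "pow_sum 4 q = q * (1 + 11 * q + 11 * q ^ 2 + q ^ 3) / d ^ 5" .
  have "d * pow_sum 5 q = q * (pow_sum 0 q + 5 * pow_sum 1 q + 10 * pow_sum 2 q + 10 * pow_sum 3 q + 5 * pow_sum 4 q)"
    using rec[of 5] by (simp add: lessThan_nat_numeral lessThan_Suc numeral_eq_Suc)
  hence "pow_sum 5 q = q * (pow_sum 0 q + 5 * pow_sum 1 q + 10 * pow_sum 2 q + 10 * pow_sum 3 q + 5 * pow_sum 4 q) / d"
    using d(1) by (simp add: field_simps)
  also have "\<dots> = q * (d ^ 4 + 5 * q * d ^ 3 + 10 * q * (1 + q) * d ^ 2 + 10 * q * (1 + 4 * q + q ^ 2) * d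
      + 5 * q * (1 + 11 * q + 11 * q ^ 2 + q ^ 3)) / d ^ 6"
    unfolding One_nat_def s0 s1 s2 s3 s4 using d(1) by (simp add: field_simps eval_nat_numeral)
  also have "d ^ 4 + 5 * q * d ^ 3 + 10 * q * (1 + q) * d ^ 2 + 10 * q * (1 + 4 * q + q ^ 2) * d
      + 5 * q * (1 + 11 * q + 11 * q ^ 2 + q ^ 3) = 1 + 26 * q + 66 * q ^ 2 + 26 * q ^ 3 + q ^ 4"
    by (simp add: d(2) eval_nat_numeral algebra_simps)
  finally have s5: "pow_sum 5 q = q * (1 + 26 * q + 66 * q ^ 2 + 26 * q ^ 3 + q ^ 4) / d ^ 6" .
  have Y: "Y = d ^ 2 / q" by (simp add: Y_def d_def)
  have "Y + 4 = (1 + q) ^ 2 / q" using q by (simp add: Y_def field_simps power2_eq_square)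
  hence "(Y + 4) / Y ^ 3 = ((1 + q) ^ 2 / q) / (d ^ 2 / q) ^ 3" by (simp only: Y)
  also have "\<dots> = (pow_sum 2 q)\<^sup>2"
    using d(1) q by (simp add: s2 field_simps) (simp add: eval_nat_numeral algebra_simps)
  finally show "(pow_sum 2 q)\<^sup>2 = (Y + 4) / Y ^ 3" ..
  have "Y + 6 = (1 + 4 * q + q ^ 2) / q" using q by (simp add: Y_def field_simps power2_eq_square)
  hence "(Y + 6) / Y\<^sup>2 = ((1 + 4 * q + q ^ 2) / q) / (d ^ 2 / q)\<^sup>2" by (simp only: Y)
  also have "\<dots> = pow_sum 3 q"
    using d(1) q by (simp add: s3 field_simps) (simp add: eval_nat_numeral algebra_simps)
  finally show "pow_sum 3 q = (Y + 6) / Y\<^sup>2" ..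
  have "Y\<^sup>2 + 30 * Y + 120 = (1 + 26 * q + 66 * q ^ 2 + 26 * q ^ 3 + q ^ 4) / q ^ 2"
    using q by (simp add: Y_def field_simps) (simp add: eval_nat_numeral algebra_simps)
  hence "(Y\<^sup>2 + 30 * Y + 120) / Y ^ 3 = ((1 + 26 * q + 66 * q ^ 2 + 26 * q ^ 3 + q ^ 4) / q ^ 2) / (d ^ 2 / q) ^ 3"
    by (simp only: Y)
  also have "\<dots> = pow_sum 5 q"
    using d(1) q by (simp add: s5 field_simps) (simp add: eval_nat_numeral algebra_simps)
  finally show "pow_sum 5 q = (Y\<^sup>2 + 30 * Y + 120) / Y ^ 3" ..
qed

text \<open>All terms of the cosh series are nonnegative; the partial sum through
  \<open>x ^ 8\<close> is kept.\<close>

lemma cosh_lower: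
  fixes x :: real
  shows "x\<^sup>2 * (1 + x\<^sup>2 / 12 + x\<^sup>2 ^ 2 / 360 + x\<^sup>2 ^ 3 / 20160) \<le> 2 * cosh x - 2"
proof -
  let ?f = "\<lambda>n. if even n then x ^ n /\<^sub>R fact n else 0"
  have s: "?f sums cosh x" by (rule cosh_converges)
  have "sum ?f {..<9} \<le> suminf ?f"
    by (intro sum_le_suminf sums_summable[OF s]) (auto simp: zero_le_even_power)
  hence "sum ?f {..<9} \<le> cosh x" using s by (simp add: sums_iff)
  moreover have "{..<9} = {0, 1, 2, 3, 4, 5, 6, 7, 8 :: nat}" by auto
  ultimately show ?thesis by (simp add: fact_numeral field_simps power_mult[symmetric])
qed

text \<open>For \<open>q = exp (- x)\<close> the quantity \<open>(1 - q)\<^sup>2 / q\<close> of the closed forms is \<open>2 * cosh x - 2\<close>.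
  The constants 2 and 120 are the limits for \<open>x \<rightarrow> 0\<close>; the last bound fails for large \<open>x\<close>.\<close>

lemma pow_sum_exp_le:
  fixes x :: real
  assumes x: "0 < x"
  shows "pow_sum 2 (exp (- x)) \<le> 2 / x ^ 3" "pow_sum 3 (exp (- x)) \<le> 6.12 / x ^ 4"
    "pow_sum 5 (exp (- x)) \<le> 180 / x ^ 6" "x \<le> 1 / 5 \<Longrightarrow> pow_sum 5 (exp (- x)) \<le> 120 / x ^ 6"
proof -
  define q where "q = exp (- x)"
  define Y where "Y = (1 - q)\<^sup>2 / q"
  define u where "u = x\<^sup>2"
  define w where "w = Y / u"
  have q: "0 < q" "q < 1" using x by (auto simp: q_def)
  have u: "0 < u" using x by (simp add: u_def)
  have "Y = 2 * cosh x - 2"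
    by (simp add: Y_def q_def cosh_def exp_minus field_simps power2_eq_square)
  hence wl: "1 + u / 12 + u ^ 2 / 360 + u ^ 3 / 20160 \<le> w"
    using cosh_lower[of x] u by (simp add: w_def u_def field_simps)
  \<comment> \<open>At fixed \<open>u\<close> the closed forms are sums of negative powers of
    \<open>w\<close>, so replacing \<open>w\<close> by its polynomial lower bound \<open>v\<close>
    only increases them.\<close>
  define v where "v = 1 + u / 12 + u ^ 2 / 360 + u ^ 3 / 20160"
  have v: "1 \<le> v" "v \<le> w" using u wl by (auto simp: v_def)
  have Y: "Y = u * w" "0 < Y" using u q by (auto simp: w_def Y_def)
  have un: "0 \<le> u * u"
    "0 \<le> u * (u * u)"
    "0 \<le> u * (u * (u * u))"
    "0 \<le> u * (u * (u * (u * u)))"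
    "0 \<le> u * (u * (u * (u * (u * u))))"
    using u by simp_all
  note cf = pow_sum_closed_forms[OF q, folded Y_def]
  have mono: "1 / w ^ k \<le> 1 / v ^ k" for k using v by (intro divide_left_mono power_mono) auto
  have pos: "0 \<le> pow_sum 2 q" unfolding pow_sum_def
    using q by (intro suminf_nonneg summable_pow_geometric) auto
  show "pow_sum 2 (exp (- x)) \<le> 2 / x ^ 3"
  proof (rule power2_le_imp_le)
    have "(pow_sum 2 q)\<^sup>2 = (u * (1 / w ^ 2) + 4 * (1 / w ^ 3)) / u ^ 3"
      unfolding cf Y(1) using u v by (simp add: field_simps) (simp add: eval_nat_numeral algebra_simps)
    also have "\<dots> \<le> (u * (1 / v ^ 2) + 4 * (1 / v ^ 3)) / u ^ 3"
      using u by (intro divide_right_mono add_mono mult_left_mono mono) auto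
    also have "u * (1 / v ^ 2) + 4 * (1 / v ^ 3) = (u * v + 4) / v ^ 3"
      using v by (simp add: field_simps eval_nat_numeral)
    also have "(u * v + 4) / v ^ 3 \<le> 4"
    proof -
      have "0 \<le> 4 * v ^ 3 - u * v - 4" unfolding v_def
        using u by (simp add: eval_nat_numeral algebra_simps)
      thus ?thesis using v by (simp add: field_simps)
    qed
    finally have "(pow_sum 2 q)\<^sup>2 \<le> 4 / u ^ 3" using u by (simp add: divide_right_mono)
    thus "(pow_sum 2 (exp (- x)))\<^sup>2 \<le> (2 / x ^ 3)\<^sup>2"
      by (simp add: q_def u_def power_divide power_mult[symmetric])
  qed (use x in simp)
  have "pow_sum 3 q = (u * (1 / w) + 6 * (1 / w ^ 2)) / u ^ 2"
    unfolding cf Y(1) using u v by (simp add: field_simps eval_nat_numeral)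
  also have "\<dots> \<le> (u * (1 / v) + 6 * (1 / v ^ 2)) / u ^ 2"
    using u mono[of 1] by (intro divide_right_mono add_mono mult_left_mono mono) auto
  also have "u * (1 / v) + 6 * (1 / v ^ 2) = (u * v + 6) / v ^ 2"
    using v by (simp add: field_simps eval_nat_numeral)
  also have "(u * v + 6) / v ^ 2 \<le> 6.12"
  proof -
    \<comment> \<open>The limit value 6 itself would be too small, since the sum exceeds
      \<open>6 / x ^ 4\<close> for small \<open>x\<close>; 6.12 gives the slack 0.12. The quadratic
      factor is positive because \<open>0.0006 * 5.75 ^ 2 < 0.02\<close>.\<close>
    have "0 \<le> 0.12 + u * (0.02 - 0.0069 * u + 0.0006 * u ^ 2)"
    proof -
      have "0 \<le> 0.02 - 0.0069 * u + 0.0006 * u ^ 2"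
        using zero_le_power2[of "u - 5.75"] by (simp add: power2_eq_square algebra_simps)
      thus ?thesis using u by simp
    qed
    also have "\<dots> \<le> 6.12 * v ^ 2 - u * v - 6" unfolding v_def
      using u by (simp add: eval_nat_numeral algebra_simps) (use un in linarith)
    finally show ?thesis using v by (simp add: field_simps)
  qed
  finally show "pow_sum 3 (exp (- x)) \<le> 6.12 / x ^ 4"
    using u by (simp add: q_def u_def divide_right_mono power_mult[symmetric])
  have "pow_sum 5 q = (u ^ 2 * (1 / w) + 30 * u * (1 / w ^ 2) + 120 * (1 / w ^ 3)) / u ^ 3"
    unfolding cf Y(1) using u v by (simp add: field_simps) (simp add: eval_nat_numeral algebra_simps)
  also have "\<dots> \<le> (u ^ 2 * (1 / v) + 30 * u * (1 / v ^ 2) + 120 * (1 / v ^ 3)) / u ^ 3"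
    using u mono[of 1] by (intro divide_right_mono add_mono mult_left_mono mono) auto
  also have "u ^ 2 * (1 / v) + 30 * u * (1 / v ^ 2) + 120 * (1 / v ^ 3) = (u ^ 2 * v ^ 2 + 30 * u * v + 120) / v ^ 3"
    using v by (simp add: field_simps eval_nat_numeral)
  finally have S5: "pow_sum 5 q \<le> (u ^ 2 * v ^ 2 + 30 * u * v + 120) / v ^ 3 / u ^ 3" .
  \<comment> \<open>With 180 all coefficients of the difference are positive, so the bound needs no
    restriction on \<open>x\<close>.\<close>
  have eq: "180 * v ^ 3 - (u ^ 2 * v ^ 2 + 30 * u * v + 120) =
      60 / 1 + 15 / 1 * u + 7 / 4 * u ^ 2 + 11 / 84 * u ^ 3 + 17 / 3360 * u ^ 4 + 29 / 241920 * u ^ 5 + 163 / 101606400 * u ^ 6 + 17 / 406425600 * u ^ 7 + 1 / 812851200 * u ^ 8 + 1 / 45519667200 * u ^ 9"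
    unfolding v_def by (simp add: eval_nat_numeral field_simps)
  have "0 \<le> 180 * v ^ 3 - (u ^ 2 * v ^ 2 + 30 * u * v + 120)"
    unfolding eq using u by (intro add_nonneg_nonneg) auto
  hence "(u ^ 2 * v ^ 2 + 30 * u * v + 120) / v ^ 3 \<le> 180" using v by (simp add: field_simps)
  hence "pow_sum 5 q \<le> 180 / u ^ 3" using u by (intro order_trans[OF S5] divide_right_mono) auto
  thus "pow_sum 5 (exp (- x)) \<le> 180 / x ^ 6" by (simp add: q_def u_def power_mult[symmetric])
  assume "x \<le> 1 / 5"
  hence "u \<le> (1 / 5)\<^sup>2" unfolding u_def using x by (intro power_mono) auto
  hence u1: "u \<le> 1" by (simp add: power2_eq_square)
  \<comment> \<open>With 120 everything below \<open>u ^ 3\<close> cancels; the leading coefficient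
    \<open>1 / 252\<close> dominates the negative ones for \<open>u \<le> 1\<close>.\<close>
  have eq': "120 * v ^ 3 - (u ^ 2 * v ^ 2 + 30 * u * v + 120) =
      u ^ 3 * (1 / 252 - 13 / 10080 * u - 13 / 120960 * u ^ 2 - 649 / 152409600 * u ^ 3 - 13 / 203212800 * u ^ 4)
      + 1 / 68279500800 * u ^ 9"
    unfolding v_def by (simp add: eval_nat_numeral field_simps)
  have "u ^ 2 \<le> 1" "u ^ 3 \<le> 1" "u ^ 4 \<le> 1" using u u1 by (simp_all add: power_le_one)
  with u1 have "0 \<le> 1 / 252 - 13 / 10080 * u - 13 / 120960 * u ^ 2 - 649 / 152409600 * u ^ 3 - 13 / 203212800 * u ^ 4"
    by linarith
  hence "0 \<le> 120 * v ^ 3 - (u ^ 2 * v ^ 2 + 30 * u * v + 120)"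
    unfolding eq' using u by (intro add_nonneg_nonneg mult_nonneg_nonneg) auto
  hence "(u ^ 2 * v ^ 2 + 30 * u * v + 120) / v ^ 3 \<le> 120" using v by (simp add: field_simps)
  hence "pow_sum 5 q \<le> 120 / u ^ 3" using u by (intro order_trans[OF S5] divide_right_mono) auto
  thus "pow_sum 5 (exp (- x)) \<le> 120 / x ^ 6" by (simp add: q_def u_def power_mult[symmetric])
qed

section \<open>Upper bounds for the moments\<close>

text \<open>For \<open>r \<ge> 1\<close>, the \<open>r\<close>-th cumulant of the distribution with
  weights proportional to \<open>pp n * q ^ n\<close>: \<open>r = 1\<close> is its mean,
  \<open>r = 2\<close> its variance.\<close>

definition moment :: "real \<Rightarrow> nat \<Rightarrow> real" where
  "moment q r = (\<Sum>j. log_coeff j * q ^ j * real j ^ r)"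

text \<open>The term \<open>1 / 8\<close> is exact; from 3 on, \<open>1 / m ^ 3\<close> is compared
  with \<open>1 / ((m - 1) * m * (m + 1))\<close>, which telescopes to
  \<open>1 / 12\<close>.\<close>

lemma sum_inverse_cubes: "(\<Sum>m\<in>{2..M}. 1 / real m ^ 3) \<le> 5 / 24"
proof -
  have *: "(\<Sum>m\<in>{2..M}. 1 / real m ^ 3) \<le> 5 / 24 - 1 / (2 * real M * (real M + 1))" if "2 \<le> M" for M
    using that
  proof (induction M rule: dec_induct)
    case base
    show ?case by simp
  next
    case (step M)
    have "1 / real (Suc M) ^ 3 \<le> 1 / (real M * real (Suc M) * (real M + 2))"
    proof (rule divide_left_mono)
      have "real (Suc M) ^ 3 = real M * real (Suc M) * (real M + 2) + real (Suc M)"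
        by (simp add: eval_nat_numeral algebra_simps)
      thus "real M * real (Suc M) * (real M + 2) \<le> real (Suc M) ^ 3" by simp
    qed (use step in auto)
    also have "\<dots> = 1 / (2 * real M * (real M + 1)) - 1 / (2 * real (Suc M) * (real (Suc M) + 1))"
    proof -
      have "1 / (x * (x + 1) * (x + 2)) = 1 / (2 * x * (x + 1)) - 1 / (2 * (x + 1) * (x + 1 + 1))"
        if "0 < x" for x :: real
      proof -
        have "x + 1 \<noteq> 0" "x + 2 \<noteq> 0" "x + 1 + 1 \<noteq> 0" using that by auto
        thus ?thesis using that by (simp add: divide_simps) (simp add: algebra_simps)?
      qed
      from this[of "real M"] show ?thesis using step by (simp add: add.commute)
    qed
    finally show ?case using step by (simp add: sum.atLeast_Suc_atMost_Suc_shift)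
  qed
  show ?thesis
  proof (cases "2 \<le> M")
    case True
    have "0 \<le> 1 / (2 * real M * (real M + 1))" by simp
    with *[OF True] show ?thesis by linarith
  qed auto
qed

lemma sum_power_le_pow_sum:
  assumes "0 < q" "q < 1"
  shows "(\<Sum>k\<in>{1..J}. real k ^ a * q ^ k) \<le> pow_sum a q"
  unfolding pow_sum_def using assms
  by (intro sum_le_suminf summable_pow_geometric) auto

text \<open>Writing \<open>j = k * m\<close> with the divisor \<open>k\<close> of
  \<open>sigma2\<close> turns the sum into one over pairs; as terms are nonnegative, the pairs with
  \<open>k * m < J\<close> may be enlarged to a square. Summing over \<open>k\<close> leaves a power
  sum at \<open>m * s\<close>.\<close>

lemma moment_partial_le:
  assumes "0 < s"
  shows "(\<Sum>j<J. log_coeff j * exp (- s) ^ j * real j ^ Suc r)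
    \<le> (\<Sum>m\<in>{1..J}. real m ^ r * pow_sum (r + 2) (exp (- (real m * s))))"
proof -
  define g where "g k m = real m ^ r * (real k ^ (r + 2) * exp (- (real m * s)) ^ k)" for k m :: nat
  have g: "0 \<le> g k m" for k m by (simp add: g_def)
  have coeff: "log_coeff j * exp (- s) ^ j * real j ^ Suc r = (\<Sum>k\<in>{k. k dvd j}. g k (j div k))" if "0 < j" for j
  proof -
    have "log_coeff j * exp (- s) ^ j * real j ^ Suc r = real (sigma2 j) * (exp (- s) ^ j * real j ^ r)"
      using that by (simp add: log_coeff_def)
    also have "real (sigma2 j) = (\<Sum>k | k dvd j. real k ^ 2)" by (simp add: sigma2_def)
    also have "\<dots> * (exp (- s) ^ j * real j ^ r) = (\<Sum>k | k dvd j. g k (j div k))"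
      unfolding sum_distrib_right
    proof (rule sum.cong[OF refl])
      fix k assume "k \<in> {k. k dvd j}"
      then obtain m where m: "j = k * m" by auto
      hence "0 < k" using that by (auto intro: Nat.gr0I)
      have "exp (- s) ^ j = exp (- (real m * s)) ^ k"
        by (simp add: m exp_of_nat_mult[symmetric] mult_ac)
      thus "real k ^ 2 * (exp (- s) ^ j * real j ^ r) = g k (j div k)"
        using \<open>0 < k\<close> by (simp add: g_def m power_mult_distrib power_add power2_eq_square mult_ac)
    qed
    finally show ?thesis .
  qed
  have "(\<Sum>j<J. log_coeff j * exp (- s) ^ j * real j ^ Suc r) = (\<Sum>j\<in>{1..<J}. log_coeff j * exp (- s) ^ j * real j ^ Suc r)"
    by (rule sum.mono_neutral_right) (auto simp: not_less_eq_eq Suc_le_eq)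
  also have "\<dots> = (\<Sum>j\<in>{1..<J}. \<Sum>k\<in>{k. k dvd j}. g k (j div k))"
    by (intro sum.cong refl coeff) auto
  also have "\<dots> = (\<Sum>(j, k)\<in>Sigma {1..<J} (\<lambda>j. {k. k dvd j}). g k (j div k))"
    by (rule sum.Sigma) auto
  also have "\<dots> = (\<Sum>(m, k)\<in>(\<lambda>(j, k). (j div k, k)) ` Sigma {1..<J} (\<lambda>j. {k. k dvd j}). g k m)"
    by (subst sum.reindex) (auto simp: inj_on_def case_prod_unfold elim!: dvdE)
  also have "\<dots> \<le> (\<Sum>(m, k)\<in>{1..J} \<times> {1..J}. g k m)"
  proof (rule sum_mono2)
    show "(\<lambda>(j, k). (j div k, k)) ` Sigma {1..<J} (\<lambda>j. {k. k dvd j}) \<subseteq> {1..J} \<times> {1..J}"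
    proof clarify
      fix j k :: nat assume *: "j \<in> {1..<J}" "k dvd j"
      then obtain m where m: "j = k * m" by auto
      with * have "0 < k" "0 < m" by (auto intro: Nat.gr0I)
      hence "m \<le> k * m" "k \<le> k * m" by auto
      moreover have "k * m < J" using * m by simp
      ultimately have "m \<le> J" "k \<le> J" by linarith+
      with m \<open>0 < k\<close> \<open>0 < m\<close> show "j div k \<in> {1..J} \<and> k \<in> {1..J}" by auto
    qed
  qed (use g in auto)
  also have "\<dots> = (\<Sum>m\<in>{1..J}. real m ^ r * (\<Sum>k\<in>{1..J}. real k ^ (r + 2) * exp (- (real m * s)) ^ k))"
    by (simp add: sum.cartesian_product[symmetric] g_def sum_distrib_left)
  also have "\<dots> \<le> (\<Sum>m\<in>{1..J}. real m ^ r * pow_sum (r + 2) (exp (- (real m * s))))"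
    using assms by (intro sum_mono mult_left_mono sum_power_le_pow_sum) auto
  finally show ?thesis .
qed

lemma summable_moment:
  assumes "0 \<le> q" "q < 1"
  shows "summable (\<lambda>j. log_coeff j * q ^ j * real j ^ r)"
  by (rule summable_log_coeff[where C = 1 and k = r]) (use assms in auto)

text \<open>The term \<open>m = 1\<close> may use a sharper constant \<open>C1\<close>, valid at the
  given \<open>s\<close>; the terms \<open>m \<ge> 2\<close> use the uniform \<open>C\<close> and
  sum to the factor \<open>5 / 24\<close>.\<close>

lemma moment_le:
  assumes s: "0 < s"
    and bound: "\<And>x. 0 < x \<Longrightarrow> pow_sum (r + 2) (exp (- x)) \<le> C / x ^ (r + 3)"
    and bound1: "pow_sum (r + 2) (exp (- s)) \<le> C1 / s ^ (r + 3)"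
    and C: "0 \<le> C" "0 \<le> C1"
  shows "moment (exp (- s)) (Suc r) \<le> (C1 + C * (5 / 24)) / s ^ (r + 3)"
  unfolding moment_def
proof (rule suminf_le_const[OF summable_moment])
  fix J
  have tm: "real m ^ r * pow_sum (r + 2) (exp (- (real m * s))) \<le> C / s ^ (r + 3) * (1 / real m ^ 3)"
    if "1 \<le> m" for m
  proof -
    have "real m ^ r * pow_sum (r + 2) (exp (- (real m * s))) \<le> real m ^ r * (C / (real m * s) ^ (r + 3))"
      using that s by (intro mult_left_mono bound) auto
    also have "\<dots> = C / s ^ (r + 3) * (1 / real m ^ 3)"
      using that s by (simp add: power_mult_distrib power_add field_simps)
    finally show ?thesis .
  qed
  have "(\<Sum>j<J. log_coeff j * exp (- s) ^ j * real j ^ Suc r)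
      \<le> (\<Sum>m\<in>{1..J}. real m ^ r * pow_sum (r + 2) (exp (- (real m * s))))"
    by (rule moment_partial_le[OF s])
  also have "\<dots> \<le> C1 / s ^ (r + 3) + (\<Sum>m\<in>{2..J}. C / s ^ (r + 3) * (1 / real m ^ 3))"
  proof (cases "1 \<le> J")
    case True
    hence "{1..J} = insert 1 {2..J}" by auto
    hence "(\<Sum>m\<in>{1..J}. real m ^ r * pow_sum (r + 2) (exp (- (real m * s)))) =
      pow_sum (r + 2) (exp (- s)) + (\<Sum>m\<in>{2..J}. real m ^ r * pow_sum (r + 2) (exp (- (real m * s))))" by simp
    also have "\<dots> \<le> C1 / s ^ (r + 3) + (\<Sum>m\<in>{2..J}. C / s ^ (r + 3) * (1 / real m ^ 3))"
      by (intro add_mono bound1 sum_mono tm) auto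
    finally show ?thesis .
  qed (use C s in auto)
  also have "\<dots> \<le> C1 / s ^ (r + 3) + C / s ^ (r + 3) * (5 / 24)"
    unfolding sum_distrib_left[symmetric] using C s
    by (intro add_mono mult_left_mono sum_inverse_cubes) auto
  also have "\<dots> = (C1 + C * (5 / 24)) / s ^ (r + 3)" by (simp add: add_divide_distrib)
  finally show "(\<Sum>j<J. log_coeff j * exp (- s) ^ j * real j ^ Suc r) \<le> (C1 + C * (5 / 24)) / s ^ (r + 3)" .
qed (use s in auto)

text \<open>The constants are \<open>2 * 29 / 24\<close>, \<open>6.12 * 29 / 24\<close> and
  \<open>120 + 180 * 5 / 24\<close>.\<close>

lemma moment_bounds:
  assumes s: "0 < s"
  shows "moment (exp (- s)) 1 \<le> 29 / 12 / s ^ 3" "moment (exp (- s)) 2 \<le> 7.395 / s ^ 4"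
    "s \<le> 1 / 5 \<Longrightarrow> moment (exp (- s)) 4 \<le> 157.5 / s ^ 6"
proof -
  have "moment (exp (- s)) (Suc 0) \<le> (2 + 2 * (5 / 24)) / s ^ (0 + 3)"
    by (rule moment_le[OF s]; use s pow_sum_exp_le(1) in \<open>simp add: numeral_eq_Suc\<close>)
  thus "moment (exp (- s)) 1 \<le> 29 / 12 / s ^ 3" by simp
  have "moment (exp (- s)) (Suc 1) \<le> (6.12 + 6.12 * (5 / 24)) / s ^ (1 + 3)"
    by (rule moment_le[OF s]; use s pow_sum_exp_le(2) in \<open>simp add: numeral_eq_Suc\<close>)
  thus "moment (exp (- s)) 2 \<le> 7.395 / s ^ 4" by (simp add: numeral_2_eq_2)
  show "moment (exp (- s)) 4 \<le> 157.5 / s ^ 6" if "s \<le> 1 / 5"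
  proof -
    have "moment (exp (- s)) (Suc 3) \<le> (120 + 180 * (5 / 24)) / s ^ (3 + 3)"
      by (rule moment_le[OF s]; use s that pow_sum_exp_le(3,4) in simp)
    thus ?thesis by simp
  qed
qed

text \<open>Cauchy-Schwarz for \<open>j\<close> and \<open>j ^ 2\<close> under the weights
  \<open>log_coeff j * q ^ j\<close>, through the nonnegative quadratic form in \<open>c\<close> and
  \<open>d\<close>.\<close>

lemma moment_3_squared_le:
  assumes q: "0 < q" "q < 1"
  shows "(moment q 3)\<^sup>2 \<le> moment q 2 * moment q 4"
proof -
  note s = summable_moment[of q, OF less_imp_le[OF q(1)] q(2)]
  have pos: "0 \<le> moment q r" for r unfolding moment_def
    using q log_coeff_bounds by (intro suminf_nonneg s) auto
  have quad: "0 \<le> c\<^sup>2 * moment q 2 - 2 * (c * d) * moment q 3 + d\<^sup>2 * moment q 4" for c d :: real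
  proof -
    have "(\<lambda>j. c\<^sup>2 * (log_coeff j * q ^ j * real j ^ 2) - 2 * (c * d) * (log_coeff j * q ^ j * real j ^ 3) + d\<^sup>2 * (log_coeff j * q ^ j * real j ^ 4))
        sums (c\<^sup>2 * moment q 2 - 2 * (c * d) * moment q 3 + d\<^sup>2 * moment q 4)"
      unfolding moment_def by (intro sums_add sums_diff sums_mult summable_sums s)
    moreover have "0 \<le> c\<^sup>2 * (log_coeff j * q ^ j * real j ^ 2) - 2 * (c * d) * (log_coeff j * q ^ j * real j ^ 3) + d\<^sup>2 * (log_coeff j * q ^ j * real j ^ 4)" for j
    proof -
      have "0 \<le> log_coeff j * q ^ j * real j ^ 2 * (c - d * real j)\<^sup>2"
        using q log_coeff_bounds(3)[of j] by simp
      thus ?thesis by (simp add: eval_nat_numeral algebra_simps)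
    qed
    ultimately show ?thesis by (metis (no_types, lifting) sums_iff suminf_nonneg)
  qed
  show ?thesis
  proof (cases "moment q 2 = 0")
    case True
    have "moment q 3 \<le> 0"
    proof (rule ccontr)
      assume "\<not> moment q 3 \<le> 0"
      with quad[of "(moment q 4 + 1) / (2 * moment q 3)" 1] True show False by simp
    qed
    hence "moment q 3 = 0" using pos[of 3] by simp
    thus ?thesis using True by simp
  next
    case False
    hence "0 < moment q 2" using pos[of 2] by simp
    have "0 \<le> moment q 2 * (moment q 2 * moment q 4 - (moment q 3)\<^sup>2)"
      using quad[of "moment q 3" "moment q 2"] by (simp add: power2_eq_square algebra_simps)
    thus ?thesis using \<open>0 < moment q 2\<close> by (simp add: zero_le_mult_iff)
  qed
qed

section \<open>Saddle point and positivity of the integral\<close>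

lemma one_minus_cos_le: "1 - cos x \<le> x\<^sup>2 / 2" for x :: real
proof -
  have "1 - cos x = 2 * (sin (x / 2))\<^sup>2" using cos_double_sin[of "x / 2"] by simp
  also have "(sin (x / 2))\<^sup>2 \<le> (x / 2)\<^sup>2" using abs_sin_x_le_abs_x[of "x / 2"] by (rule abs_le_square_iff[THEN iffD1])
  finally show ?thesis by (simp add: power2_eq_square)
qed

lemma abs_sin_minus_le: "\<bar>sin x - x\<bar> \<le> \<bar>x\<bar> ^ 3 / 6" for x :: real
  using Maclaurin_sin_bound[of x 3]
  by (simp add: numeral_3_eq_3 sin_coeff_def fact_numeral)

lemma one_minus_cos_ge:
  fixes x :: real
  assumes "0 \<le> x" "x \<le> 1"
  shows "x\<^sup>2 / 2 * (1 - x\<^sup>2 / 12) \<le> 1 - cos x"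
proof -
  define y where "y = x / 2"
  have y: "0 \<le> y" "y \<le> 1 / 2" using assms by (auto simp: y_def)
  have y2: "y ^ 2 \<le> 1" using y by (intro power_le_one) auto
  have "0 \<le> y - y ^ 3 / 6" using mult_left_mono[OF y2 y(1)] y(1) by (simp add: eval_nat_numeral)
  moreover have "y - y ^ 3 / 6 \<le> sin y" using abs_sin_minus_le[of y] y(1) unfolding abs_of_nonneg[OF y(1)] by linarith
  ultimately have "(y - y ^ 3 / 6)\<^sup>2 \<le> (sin y)\<^sup>2" by (intro power_mono)
  hence "y\<^sup>2 - y ^ 4 / 3 \<le> (sin y)\<^sup>2" using zero_le_power2[of "y ^ 3 / 6"]
    by (simp add: power2_eq_square eval_nat_numeral algebra_simps)
  moreover have "1 - cos x = 2 * (sin y)\<^sup>2" using cos_double_sin[of y] by (simp add: y_def)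
  ultimately show ?thesis by (simp add: y_def eval_nat_numeral algebra_simps)
qed

lemma decay_le:
  assumes "0 \<le> q" "q < 1"
  shows "decay q t \<le> moment q 2 * t\<^sup>2 / 2"
proof -
  have s1: "summable (\<lambda>j. log_coeff j * q ^ j * (1 - cos (real j * t)))"
  proof (rule summable_log_coeff[OF assms, where C = 2 and k = 0])
    show "\<bar>1 - cos (real j * t)\<bar> \<le> 2 * real j ^ 0" for j
      using cos_ge_minus_one[of "real j * t"] cos_le_one[of "real j * t"] by simp
  qed
  have s2: "summable (\<lambda>j. log_coeff j * q ^ j * real j ^ 2)" by (rule summable_moment[OF assms])
  have "decay q t \<le> (\<Sum>j. log_coeff j * q ^ j * real j ^ 2 * (t\<^sup>2 / 2))"
    unfolding decay_def
  proof (rule suminf_le[OF _ s1 summable_mult2[OF s2]])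
    fix j
    have "log_coeff j * q ^ j * (1 - cos (real j * t)) \<le> log_coeff j * q ^ j * ((real j * t)\<^sup>2 / 2)"
      using assms log_coeff_bounds(3)[of j] by (intro mult_left_mono one_minus_cos_le) auto
    thus "log_coeff j * q ^ j * (1 - cos (real j * t)) \<le> log_coeff j * q ^ j * real j ^ 2 * (t\<^sup>2 / 2)"
      by (simp add: power_mult_distrib)
  qed
  also have "\<dots> = moment q 2 * (t\<^sup>2 / 2)" unfolding moment_def by (rule suminf_mult2[OF s2, symmetric])
  finally show ?thesis by simp
qed

text \<open>At the saddle point the linear part of the phase cancels, leaving the sum of
  \<open>sin x - x\<close>, bounded by the third moment. Squaring lets Cauchy-Schwarz replace that
  moment by the second and fourth.\<close>

lemma phase_squared_le:
  assumes q: "0 < q" "q < 1" and n: "moment q 1 = real n"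
  shows "(phase q n t)\<^sup>2 \<le> moment q 2 * moment q 4 * t ^ 6 / 36"
proof -
  note q' = less_imp_le[OF q(1)] q(2)
  have s1: "summable (\<lambda>j. log_coeff j * q ^ j * sin (real j * t))"
    by (rule summable_log_coeff[OF q', where C = 1 and k = 0]) auto
  have s2: "summable (\<lambda>j. log_coeff j * q ^ j * real j ^ 1)" by (rule summable_moment[OF q'])
  have s3: "summable (\<lambda>j. log_coeff j * q ^ j * real j ^ 3)" by (rule summable_moment[OF q'])
  have "phase q n t = (\<Sum>j. log_coeff j * q ^ j * sin (real j * t)) - (\<Sum>j. log_coeff j * q ^ j * real j ^ 1 * t)"
    unfolding phase_def n[symmetric] moment_def suminf_mult2[OF s2] ..
  also have "\<dots> = (\<Sum>j. log_coeff j * q ^ j * (sin (real j * t) - real j * t))"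
    by (subst suminf_diff[OF s1 summable_mult2[OF s2]]) (simp add: algebra_simps)
  also have "\<bar>\<dots>\<bar> \<le> (\<Sum>j. log_coeff j * q ^ j * real j ^ 3 * (\<bar>t\<bar> ^ 3 / 6))"
  proof -
    have le: "\<bar>log_coeff j * q ^ j * (sin (real j * t) - real j * t)\<bar> \<le> log_coeff j * q ^ j * real j ^ 3 * (\<bar>t\<bar> ^ 3 / 6)" for j
    proof -
      have "\<bar>log_coeff j * q ^ j * (sin (real j * t) - real j * t)\<bar> = log_coeff j * q ^ j * \<bar>sin (real j * t) - real j * t\<bar>"
        using q log_coeff_bounds(3)[of j] by (simp add: abs_mult)
      also have "\<dots> \<le> log_coeff j * q ^ j * (\<bar>real j * t\<bar> ^ 3 / 6)"
        using q log_coeff_bounds(3)[of j] by (intro mult_left_mono abs_sin_minus_le) auto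
      finally show ?thesis by (simp add: abs_mult power_mult_distrib)
    qed
    have s: "summable (\<lambda>j. \<bar>log_coeff j * q ^ j * (sin (real j * t) - real j * t)\<bar>)"
      by (rule summable_comparison_test'[OF summable_mult2[OF s3, of "\<bar>t\<bar> ^ 3 / 6"]])
        (simp only: real_norm_def abs_abs le)
    show ?thesis
      by (rule order_trans[OF summable_rabs[OF s] suminf_le[OF le s summable_mult2[OF s3]]])
  qed
  also have "\<dots> = moment q 3 * (\<bar>t\<bar> ^ 3 / 6)" unfolding moment_def by (rule suminf_mult2[OF s3, symmetric])
  finally have "\<bar>phase q n t\<bar> \<le> moment q 3 * (\<bar>t\<bar> ^ 3 / 6)" .
  hence "\<bar>phase q n t\<bar>\<^sup>2 \<le> (moment q 3 * (\<bar>t\<bar> ^ 3 / 6))\<^sup>2" by (intro power_mono) auto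
  also have "\<dots> = (moment q 3)\<^sup>2 * (t ^ 6 / 36)"
    by (simp add: power_mult_distrib power_divide power_mult[symmetric] power_even_abs)
  also have "\<dots> \<le> (moment q 2 * moment q 4) * (t ^ 6 / 36)"
    by (intro mult_right_mono moment_3_squared_le q) auto
  finally show ?thesis by simp
qed

text \<open>Here \<open>G = cosh s - 1\<close> for \<open>q = exp (- s)\<close>. The bound keeps only the part \<open>real j\<close> of
  \<open>log_coeff j\<close> (that is, the divisor \<open>j\<close> itself), for which the series has a closed form.\<close>

lemma decay_ge:
  fixes q t :: real
  assumes q: "0 < q" "q < 1"
  defines "G \<equiv> (1 - q)\<^sup>2 / (2 * q)" and "g \<equiv> 1 - cos t"
  shows "g * (3 * G + g) / (2 * G * (G + g)\<^sup>2) \<le> decay q t"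
proof -
  define z where "z = of_real q * cis t"
  define c where "c = cos t"
  define D where "D = 1 - 2 * q * c + q\<^sup>2"
  have G: "0 < G" using q by (simp add: G_def)
  have g: "0 \<le> g" by (simp add: g_def)
  have sn: "sin t ^ 2 = 1 - c\<^sup>2" by (simp add: c_def sin_squared_eq)
  have D: "D = 2 * q * (G + g)" using q by (simp add: D_def G_def g_def c_def field_simps power2_eq_square)
  hence Dpos: "0 < D" using q G g by simp
  have "norm z < 1" using q by (simp add: z_def norm_mult)
  from sums_mult[OF geometric_deriv_sums[OF this], of z]
  have "(\<lambda>j. of_nat (Suc j) * z ^ Suc j) sums (z / (1 - z)\<^sup>2)" by (simp add: mult_ac)
  hence "(\<lambda>j. of_nat j * z ^ j) sums (z / (1 - z)\<^sup>2)" by (subst (asm) sums_Suc_iff) simp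
  from sums_Re[OF this]
  have sumz: "(\<lambda>j. real j * q ^ j * cos (real j * t)) sums Re (z / (1 - z)\<^sup>2)"
    by (simp add: z_def power_mult_distrib Complex.DeMoivre mult.assoc)
  have "norm q < 1" using q by simp
  from sums_mult[OF geometric_deriv_sums[OF this], of q]
  have "(\<lambda>j. of_nat (Suc j) * q ^ Suc j) sums (q / (1 - q)\<^sup>2)" by (simp add: mult_ac)
  hence sumq: "(\<lambda>j. real j * q ^ j) sums (q / (1 - q)\<^sup>2)" by (subst (asm) sums_Suc_iff) simp
  have "Re (z / (1 - z)\<^sup>2) = q * (c * (1 + q\<^sup>2) - 2 * q) / D\<^sup>2"
  proof -
    define X where "X = 1 - q * c"
    define S where "S = q * sin t"
    have w: "Re ((1 - z)\<^sup>2) = X\<^sup>2 - S\<^sup>2" "Im ((1 - z)\<^sup>2) = - 2 * X * S"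
      by (simp_all add: z_def power2_eq_square X_def S_def c_def algebra_simps)
    have S2: "S\<^sup>2 = q\<^sup>2 * (1 - c\<^sup>2)" by (simp add: S_def power_mult_distrib sn)
    have XS: "X\<^sup>2 + S\<^sup>2 = D" unfolding S2 by (simp add: X_def D_def power2_eq_square algebra_simps)
    have "Re (z / (1 - z)\<^sup>2) = (q * c * (X\<^sup>2 - S\<^sup>2) + q * sin t * (- 2 * X * S)) / ((X\<^sup>2 - S\<^sup>2)\<^sup>2 + (- 2 * X * S)\<^sup>2)"
      unfolding Re_divide w by (simp add: z_def c_def)
    also have "(X\<^sup>2 - S\<^sup>2)\<^sup>2 + (- 2 * X * S)\<^sup>2 = D\<^sup>2"
      unfolding XS[symmetric] by (simp add: power2_eq_square algebra_simps)
    also have "q * c * (X\<^sup>2 - S\<^sup>2) + q * sin t * (- 2 * X * S) = q * c * (X\<^sup>2 - S\<^sup>2) - 2 * X * S\<^sup>2"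
      by (simp add: S_def power2_eq_square algebra_simps)
    also have "\<dots> = q * (c * (1 + q\<^sup>2) - 2 * q)"
      unfolding S2 by (simp add: X_def power2_eq_square algebra_simps)
    finally show ?thesis .
  qed
  also have "q * (c * (1 + q\<^sup>2) - 2 * q) = 2 * q\<^sup>2 * (G - g - g * G)"
    using q by (simp add: G_def g_def c_def field_simps power2_eq_square)
  also have "2 * q\<^sup>2 * (G - g - g * G) / D\<^sup>2 = (G - g - g * G) / (2 * (G + g)\<^sup>2)"
  proof -
    have "2 * q\<^sup>2 * X / (2 * q * S)\<^sup>2 = X / (2 * S\<^sup>2)" for X S :: real
      using q by (cases "S = 0") (auto simp: field_simps power2_eq_square)
    thus ?thesis unfolding D .
  qed
  finally have Re: "Re (z / (1 - z)\<^sup>2) = (G - g - g * G) / (2 * (G + g)\<^sup>2)" .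
  have Q: "q / (1 - q)\<^sup>2 = 1 / (2 * G)" using q by (simp add: G_def)
  have diff: "(\<lambda>j. real j * q ^ j * (1 - cos (real j * t))) sums (1 / (2 * G) - (G - g - g * G) / (2 * (G + g)\<^sup>2))"
    using sums_diff[OF sumq sumz] unfolding Re Q by (simp add: algebra_simps)
  have "g * (3 * G + g) / (2 * G * (G + g)\<^sup>2) \<le> g * (3 * G + g + G\<^sup>2) / (2 * G * (G + g)\<^sup>2)"
    using G g by (intro divide_right_mono mult_left_mono) auto
  also have "\<dots> = 1 / (2 * G) - (G - g - g * G) / (2 * (G + g)\<^sup>2)"
  proof -
    have "G + g \<noteq> 0" "G \<noteq> 0" using G g by auto
    hence "1 / (2 * G) - (G - g - g * G) / (2 * (G + g)\<^sup>2) = ((G + g)\<^sup>2 - G * (G - g - g * G)) / (2 * G * (G + g)\<^sup>2)"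
      by (simp add: diff_divide_distrib)
    also have "(G + g)\<^sup>2 - G * (G - g - g * G) = g * (3 * G + g + G\<^sup>2)"
      by (simp add: power2_eq_square algebra_simps)
    finally show ?thesis ..
  qed
  also have "\<dots> = (\<Sum>j. real j * q ^ j * (1 - cos (real j * t)))" by (rule sums_unique[OF diff])
  also have "\<dots> \<le> decay q t"
    unfolding decay_def
  proof (rule suminf_le[OF _ sums_summable[OF diff]])
    show "real j * q ^ j * (1 - cos (real j * t)) \<le> log_coeff j * q ^ j * (1 - cos (real j * t))" for j
      using q log_coeff_bounds(1)[of j] by (intro mult_right_mono) auto
    show "summable (\<lambda>j. log_coeff j * q ^ j * (1 - cos (real j * t)))"
    proof (rule summable_log_coeff[where C = 2 and k = 0])
      show "\<bar>1 - cos (real j * t)\<bar> \<le> 2 * real j ^ 0" for j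
        using cos_ge_minus_one[of "real j * t"] cos_le_one[of "real j * t"] by simp
    qed (use q in auto)
  qed
  finally show ?thesis .
qed

text \<open>With \<open>x = g / G\<close> the bound of \<open>decay_ge\<close> is
  \<open>x * (3 + x) / (1 + x) ^ 2\<close> over \<open>2 * G\<close>. The constants are
  \<open>(3 + x) / (1 + x) ^ 2\<close> at \<open>x = 1 / 4\<close>, and the whole quotient at
  \<open>x = 0.23\<close> (rounded down) and at \<open>x = 1\<close>.\<close>

lemma decay_ge_cases:
  fixes q t :: real
  assumes q: "0 < q" "q < 1"
  defines "G \<equiv> (1 - q)\<^sup>2 / (2 * q)" and "g \<equiv> 1 - cos t"
  shows "4 * g \<le> G \<Longrightarrow> 2.08 * g / (2 * G\<^sup>2) \<le> decay q t"
    and "0.23 * G \<le> g \<Longrightarrow> 0.49 / (2 * G) \<le> decay q t"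
    and "G \<le> g \<Longrightarrow> 1 / (2 * G) \<le> decay q t"
proof -
  have G: "0 < G" using q by (simp add: G_def)
  have g: "0 \<le> g" by (simp add: g_def)
  have *: "C / (2 * G) \<le> decay q t" if "C * (G + g)\<^sup>2 \<le> g * (3 * G + g)" for C
  proof -
    have "C / (2 * G) = C * (G + g)\<^sup>2 / (2 * G * (G + g)\<^sup>2)" using G g by simp
    also have "\<dots> \<le> g * (3 * G + g) / (2 * G * (G + g)\<^sup>2)"
      using that G by (intro divide_right_mono) auto
    also have "\<dots> \<le> decay q t" using decay_ge[OF q, of t] by (simp add: G_def g_def)
    finally show ?thesis .
  qed
  show "2.08 * g / (2 * G\<^sup>2) \<le> decay q t" if "4 * g \<le> G"
  proof -
    have "0 \<le> (G - 4 * g) * (0.92 * G + 0.52 * g)" using that G g by simp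
    also have "\<dots> = (3 * G + g) * G - 2.08 * (G + g)\<^sup>2"
      by (simp add: power2_eq_square field_simps)
    finally have "2.08 * (G + g)\<^sup>2 \<le> (3 * G + g) * G" by simp
    hence "2.08 * (G + g)\<^sup>2 * g \<le> (3 * G + g) * G * g" using g by (intro mult_right_mono)
    hence "2.08 * g / G * (G + g)\<^sup>2 \<le> g * (3 * G + g)" using G by (simp add: field_simps)
    from *[OF this] show ?thesis using G by (simp add: power2_eq_square field_simps)
  qed
  show "0.49 / (2 * G) \<le> decay q t" if "0.23 * G \<le> g"
  proof (rule *)
    have "0 \<le> (g - 0.23 * G) * (0.51 * g + 2.1373 * G) + 0.001579 * (G * G)" using that G g by simp
    also have "\<dots> = g * (3 * G + g) - 0.49 * (G + g)\<^sup>2"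
      by (simp add: power2_eq_square field_simps)
    finally show "0.49 * (G + g)\<^sup>2 \<le> g * (3 * G + g)" by simp
  qed
  show "1 / (2 * G) \<le> decay q t" if "G \<le> g"
  proof (rule *)
    have "G * G \<le> G * g" using that G by (intro mult_left_mono) auto
    thus "1 * (G + g)\<^sup>2 \<le> g * (3 * G + g)" by (simp add: power2_eq_square algebra_simps)
  qed
qed

text \<open>\<open>G\<close> is \<open>cosh s - 1\<close>. The factor 1.0037 rounds up
  \<open>1 + s ^ 2 / 12 + s ^ 4 / 120\<close> at \<open>s = 1 / 5\<close>; the last term carries the
  remainder of the exponential, estimated with \<open>exp 1 \<le> 3\<close>.\<close>

lemma cosh_bounds:
  fixes s :: real
  assumes "0 < s" "s \<le> 1 / 5"
  defines "G \<equiv> (1 - exp (- s))\<^sup>2 / (2 * exp (- s))"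
  shows "s\<^sup>2 / 2 \<le> G" "G \<le> s\<^sup>2 / 2 * 1.0037"
proof -
  have G: "2 * G = 2 * cosh s - 2"
    by (simp add: G_def cosh_def exp_minus field_simps power2_eq_square)
  have "s\<^sup>2 * 1 \<le> s\<^sup>2 * (1 + s\<^sup>2 / 12 + s\<^sup>2 ^ 2 / 360 + s\<^sup>2 ^ 3 / 20160)"
    by (intro mult_left_mono) auto
  thus "s\<^sup>2 / 2 \<le> G" using cosh_lower[of s] G by simp
  have ex: "exp t \<le> 3" if "\<bar>t\<bar> \<le> \<bar>x\<bar>" "\<bar>x\<bar> \<le> 1" for t x :: real
    using that exp_le by (intro order_trans[OF _ exp_le]) auto
  have up: "exp x \<le> (\<Sum>m<6. x ^ m / fact m) + x ^ 6 / 240" if "\<bar>x\<bar> \<le> 1" for x :: real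
  proof -
    obtain t where t: "\<bar>t\<bar> \<le> \<bar>x\<bar>" "exp x = (\<Sum>m<6. x ^ m / fact m) + exp t / fact 6 * x ^ 6"
      using Maclaurin_exp_le[of x 6] by blast
    have "exp t / fact 6 * x ^ 6 \<le> 3 / fact 6 * x ^ 6"
      using ex[OF t(1) that] by (intro mult_right_mono divide_right_mono) auto
    thus ?thesis using t by (simp add: fact_numeral)
  qed
  have six: "{..<6} = {0, 1, 2, 3, 4, 5 :: nat}" by auto
  have "2 * cosh s \<le> 2 + s ^ 2 + s ^ 4 / 12 + s ^ 6 / 120"
    using up[of s] up[of "- s"] assms by (simp add: cosh_def six fact_numeral)
  also have "s ^ 4 = s ^ 2 * s ^ 2" by (simp add: eval_nat_numeral)
  also have "s ^ 6 = s ^ 2 * (s ^ 2 * s ^ 2)" by (simp add: eval_nat_numeral)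
  finally have "2 * cosh s - 2 \<le> s\<^sup>2 * (1 + s\<^sup>2 / 12 + s\<^sup>2 * s\<^sup>2 / 120)" by (simp add: algebra_simps)
  also have "\<dots> \<le> s\<^sup>2 * 1.0037"
  proof (rule mult_left_mono)
    have "s\<^sup>2 \<le> (1 / 5)\<^sup>2" using assms by (intro power_mono) auto
    hence *: "s\<^sup>2 \<le> 1 / 25" by (simp add: power2_eq_square)
    hence "s\<^sup>2 * s\<^sup>2 \<le> 1 / 25 * (1 / 25)" by (intro mult_mono) auto
    with * show "1 + s\<^sup>2 / 12 + s\<^sup>2 * s\<^sup>2 / 120 \<le> 1.0037" by simp
  qed simp
  finally show "G \<le> s\<^sup>2 / 2 * 1.0037" using G by simp
qed

lemma integral_ge_antiderivative:
  fixes F :: "real \<Rightarrow> real"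
  assumes "a \<le> b" "continuous_on {a..b} h"
    and deriv: "\<And>t. t \<in> {a..b} \<Longrightarrow> (F has_real_derivative F' t) (at t)"
    and le: "\<And>t. t \<in> {a..b} \<Longrightarrow> F' t \<le> h t"
  shows "F b - F a \<le> integral {a..b} h"
proof (rule has_integral_le[where f = F' and g = h])
  show "(F' has_integral F b - F a) {a..b}"
    using assms(1) deriv
    by (intro fundamental_theorem_of_calculus)
      (auto simp: has_real_derivative_iff_has_vector_derivative[symmetric] intro: DERIV_subset)
  show "(h has_integral integral {a..b} h) {a..b}"
    using assms(2) by (intro integrable_integral integrable_continuous_real)
qed (rule le)

section \<open>The saddle point\<close>

text \<open>Intermediate value theorem for the mean. At \<open>exp (- (1 / 5))\<close> it is at most
  \<open>29 / 12 * 125 \<le> 303\<close>; at \<open>exp (- (1 / n))\<close> the single term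
  \<open>j = n\<close> already gives \<open>n ^ 2 * exp (- 1) \<ge> n\<close>.\<close>

lemma exists_saddle_point:
  assumes "303 \<le> n"
  obtains s where "0 < s" "s \<le> 1 / 5" "moment (exp (- s)) 1 = real n"
proof -
  define b where "b = exp (- (1 / real n))"
  have b: "0 < b" "b < 1" using assms by (simp_all add: b_def)
  have m_eq: "moment q 1 = (\<Sum>j. (log_coeff j * real j) * q ^ j)" for q
    unfolding moment_def by (intro suminf_cong) (simp add: mult_ac)
  have cont: "isCont (\<lambda>q. moment q 1) q" if "0 \<le> q" "q < 1" for q
    unfolding m_eq
  proof (rule isCont_powser)
    define K where "K = (1 + q) / 2"
    have "0 \<le> K" "K < 1" using that by (auto simp: K_def)
    from summable_moment[OF this, of 1] show "summable (\<lambda>j. log_coeff j * real j * K ^ j)"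
      by (simp add: mult_ac)
    show "norm q < norm K" using that by (simp add: K_def)
  qed
  have "\<exists>q\<ge>exp (- (1 / 5)). q \<le> b \<and> moment q 1 = real n"
  proof (rule IVT')
    have "moment (exp (- (1 / 5))) 1 \<le> 29 / 12 / (1 / 5) ^ 3" by (rule moment_bounds) simp
    also have "\<dots> \<le> real n" using assms by (simp add: power3_eq_cube)
    finally show "moment (exp (- (1 / 5))) 1 \<le> real n" .
    have "real n \<le> real n ^ 2 * exp (- 1)"
    proof -
      have "3 * exp (- 1 :: real) \<ge> 1" using exp_le by (simp add: exp_minus field_simps)
      hence "real n * 1 \<le> real n * (real n * exp (- 1))"
        using assms by (intro mult_left_mono) (auto intro: order_trans[OF _ mult_right_mono[of 3]])
      thus ?thesis by (simp add: power2_eq_square)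
    qed
    also have "\<dots> \<le> log_coeff n * b ^ n * real n ^ 1"
    proof -
      have "b ^ n = exp (- 1)" using assms by (simp add: b_def exp_of_nat_mult[symmetric])
      thus ?thesis using mult_right_mono[OF log_coeff_bounds(1)[of n], of "exp (- 1) * real n"]
        by (simp add: power2_eq_square mult_ac)
    qed
    also have "\<dots> = (\<Sum>j\<in>{n}. log_coeff j * b ^ j * real j ^ 1)" by simp
    also have "\<dots> \<le> moment b 1"
      unfolding moment_def using b log_coeff_bounds
      by (intro sum_le_suminf summable_moment) auto
    finally show "real n \<le> moment b 1" .
    show "exp (- (1 / 5)) \<le> b" using assms by (simp add: b_def field_simps)
    show "continuous_on {exp (- (1 / 5))..b} (\<lambda>q. moment q 1)"
      using b by (intro continuous_at_imp_continuous_on ballI cont) (auto intro: order_trans[OF exp_ge_zero])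
  qed
  then obtain q where q: "exp (- (1 / 5)) \<le> q" "q \<le> b" "moment q 1 = real n" by blast
  have q0: "0 < q" using q(1) exp_gt_zero[of "- (1 / 5) :: real"] by linarith
  show thesis
  proof (rule that[of "- ln q"])
    show "0 < - ln q" using q0 q(2) b by (simp add: ln_less_zero)
    have "- (1 / 5) \<le> ln q" using q(1) q0 by (simp only: ln_ge_iff)
    thus "- ln q \<le> 1 / 5" by simp
    show "moment (exp (- (- ln q))) 1 = real n" using q0 q(3) by simp
  qed
qed

section \<open>Explicit estimates of the integral\<close>

lemma exp_ge_Taylor: "0 \<le> x \<Longrightarrow> (\<Sum>m<n. x ^ m / fact m) \<le> exp x" for x :: real
  using Maclaurin_exp_le[of x n] by (force simp: divide_nonneg_nonneg)

text \<open>Applied to \<open>v = 1 / s ^ 2\<close>. A linear bound for \<open>exp y\<close> with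
  \<open>y\<close> a quarter of the exponent is raised to the fourth power; two of the factors
  \<open>y\<close> are replaced by their minimum \<open>3.05 = 0.122 * 25\<close>.\<close>

lemma exp_ge_40_squares:
  fixes v :: real
  assumes "25 \<le> v"
  shows "40 * v\<^sup>2 \<le> exp (0.488 * v)"
proof -
  define y where "y = 0.122 * v"
  have y: "3.05 \<le> y" using assms by (simp add: y_def)
  have "(20 :: real) \<le> (\<Sum>m<6. 1 ^ m / fact m) ^ 3"
    by (simp add: lessThan_nat_numeral lessThan_Suc fact_numeral eval_nat_numeral)
  also have "\<dots> \<le> exp 1 ^ 3"
    by (intro power_mono exp_ge_Taylor sum_nonneg) auto
  also have "\<dots> = exp (3 :: real)" by (simp add: exp_of_nat_mult[symmetric])
  finally have "20 * (1 + (y - 3)) \<le> exp 3 * exp (y - 3)"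
    using y by (intro mult_mono exp_ge_add_one_self) auto
  hence "4.2 * y \<le> exp y" using y by (simp add: exp_add[symmetric])
  hence "(4.2 * y) ^ 4 \<le> exp y ^ 4" using y by (intro power_mono) auto
  also have "(4.2 * y) ^ 4 = 4.2 ^ 4 * (y\<^sup>2 * y\<^sup>2)" by (simp add: eval_nat_numeral)
  also have "exp y ^ 4 = exp (0.488 * v)" by (simp add: y_def exp_of_nat_mult[symmetric])
  finally have "4.2 ^ 4 * (y\<^sup>2 * y\<^sup>2) \<le> exp (0.488 * v)" .
  moreover have "3.05\<^sup>2 * y\<^sup>2 \<le> y\<^sup>2 * y\<^sup>2" using y by (intro mult_right_mono power_mono) auto
  moreover have "40 * v\<^sup>2 \<le> 4.2 ^ 4 * (3.05\<^sup>2 * y\<^sup>2)"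
    by (simp add: y_def power_mult_distrib eval_nat_numeral)
  moreover have "4.2 ^ 4 * (3.05\<^sup>2 * y\<^sup>2) \<le> 4.2 ^ 4 * (y\<^sup>2 * y\<^sup>2)"
    using \<open>3.05\<^sup>2 * y\<^sup>2 \<le> y\<^sup>2 * y\<^sup>2\<close> by (intro mult_left_mono) auto
  ultimately show ?thesis by (meson order_trans)
qed

text \<open>The integrals below are estimated in the variable \<open>y = t / s\<^sup>2\<close>. To obtain elementary
  antiderivatives, the core uses \<open>y\<^sup>2 \<ge> 2 * y ^ 3 - 32 / 27 * y ^ 5\<close> (tangent at \<open>y = 3 / 4\<close>) and
  \<open>2 * y ^ 8 \<le> y ^ 7 + y ^ 9\<close>, the tail \<open>y\<^sup>2 \<le> (y ^ 3 / 1.3 + 1.3 * y) / 2\<close>; the coefficients are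
  those of the resulting antiderivatives, rounded in the safe direction.\<close>

lemma core_antiderivative:
  "((\<lambda>y::real. - exp (- (3.7 * y\<^sup>2)) * (0.0387 + 0.1435 * y ^ 2 - 0.2344 * y ^ 4 - 0.0915 * y ^ 6 - 0.044 * y ^ 8))
    has_real_derivative
    exp (- (3.7 * y\<^sup>2)) * (2 * y * (- 0.00031 + 0.99975 * y ^ 2 - 0.59278 * y ^ 4 - 0.16255 * y ^ 6 - 0.1628 * y ^ 8))) (at y)"
  by (rule derivative_eq_intros refl)+ (simp add: eval_nat_numeral field_simps)

lemma core_derivative_le:
  fixes y :: real
  assumes "0 \<le> y"
  shows "2 * y * (- 0.00031 + 0.99975 * y ^ 2 - 0.59278 * y ^ 4 - 0.16255 * y ^ 6 - 0.1628 * y ^ 8)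
    \<le> y\<^sup>2 * (1 - 0.65 * y ^ 6)"
proof -
  have "2 * y * (- 0.00031 + 0.99975 * y ^ 2 - 0.59278 * y ^ 4 - 0.16255 * y ^ 6 - 0.1628 * y ^ 8)
      \<le> 2 * y * (y ^ 2 - 16 / 27 * y ^ 4 - 0.1625 * y ^ 6 - 0.1625 * y ^ 8)"
  proof (rule mult_left_mono)
    show "- 0.00031 + 0.99975 * y ^ 2 - 0.59278 * y ^ 4 - 0.16255 * y ^ 6 - 0.1628 * y ^ 8
        \<le> y ^ 2 - 16 / 27 * y ^ 4 - 0.1625 * y ^ 6 - 0.1625 * y ^ 8"
      by simp (use zero_le_power[OF assms, of 2] zero_le_power[OF assms, of 4]
        zero_le_power[OF assms, of 6] zero_le_power[OF assms, of 8] in linarith)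
  qed (use assms in simp)
  also have "\<dots> = y\<^sup>2 * (1 - 0.65 * y ^ 6)
      - (y\<^sup>2 * ((1 - 4 / 3 * y)\<^sup>2 * (1 + 2 / 3 * y)) + 0.325 * (y ^ 7 * (1 - y)\<^sup>2))"
    by (simp add: eval_nat_numeral field_simps)
  also have "\<dots> \<le> y\<^sup>2 * (1 - 0.65 * y ^ 6)"
  proof -
    have "0 \<le> y\<^sup>2 * ((1 - 4 / 3 * y)\<^sup>2 * (1 + 2 / 3 * y)) + 0.325 * (y ^ 7 * (1 - y)\<^sup>2)"
      using assms by (intro add_nonneg_nonneg mult_nonneg_nonneg) auto
    thus ?thesis by linarith
  qed
  finally show ?thesis .
qed

lemma tail_antiderivative:
  "((\<lambda>y::real. exp (- (2.06 * y\<^sup>2)) * (0.0934 * y ^ 2 + 0.2032))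
    has_real_derivative - (exp (- (2.06 * y\<^sup>2)) * (y * (0.384808 * y ^ 2 + 0.650384)))) (at y)"
  by (rule derivative_eq_intros refl)+ (simp add: eval_nat_numeral field_simps)

lemma tail_derivative_ge:
  fixes y :: real
  assumes "0 \<le> y"
  shows "y\<^sup>2 \<le> y * (0.384808 * y ^ 2 + 0.650384)"
proof -
  have "0 \<le> (y - 1.3)\<^sup>2 / 2.6" by simp
  also have "\<dots> = y\<^sup>2 / 2.6 + 0.65 - y" by (simp add: power2_eq_square field_simps)
  finally have "y \<le> y\<^sup>2 / 2.6 + 0.65" by simp
  also have "\<dots> \<le> 0.384808 * y ^ 2 + 0.650384"
    by simp (use zero_le_power2[of y] in linarith)
  finally show ?thesis using assms by (simp add: power2_eq_square mult_left_mono)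
qed

lemma DERIV_rescale:
  assumes "\<And>y. (F has_real_derivative F' y) (at y)" "c \<noteq> 0"
  shows "((\<lambda>t. A * F (t / c)) has_real_derivative (A / c * F' (t / c))) (at t)"
proof -
  have "((\<lambda>t. F (t / c)) has_real_derivative F' (t / c) * (1 / c)) (at t)"
    by (rule DERIV_chain2[OF assms(1)]) (rule derivative_eq_intros refl | use assms in simp)+
  from DERIV_cmult[OF this, of A] show ?thesis by (simp add: mult_ac)
qed

text \<open>The breakpoints: up to \<open>1.07 * s ^ 2\<close> the bound
  \<open>1 - 0.65 * y ^ 6\<close> for the cosine stays nonnegative, up to \<open>s / 2\<close> one
  has \<open>4 * g \<le> G\<close>, and from \<open>1.1 * s\<close> on \<open>G \<le> g\<close>,
  where \<open>g = 1 - cos t\<close>. Beyond the core, only the modulus is used.\<close>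

lemma integral_pos:
  assumes s: "0 < s" "s \<le> 1 / 5" and n: "moment (exp (- s)) 1 = real n"
  shows "0 < integral {0..pi} (\<lambda>t. exp (- decay (exp (- s)) t) * cos (phase (exp (- s)) n t) * (1 - cos t))"
proof -
  define q where "q = exp (- s)"
  define h where "h t = exp (- decay q t) * cos (phase q n t) * (1 - cos t)" for t
  define G where "G = (1 - q)\<^sup>2 / (2 * q)"
  have q: "0 < q" "q < 1" using s by (auto simp: q_def)
  have G: "s\<^sup>2 / 2 \<le> G" "G \<le> s\<^sup>2 / 2 * 1.0037"
    using cosh_bounds[OF s] by (simp_all add: G_def q_def)
  have s2: "0 < s\<^sup>2" "s\<^sup>2 \<le> 1 / 25"
  proof -
    have "s\<^sup>2 \<le> (1 / 5)\<^sup>2" using s by (intro power_mono) auto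
    thus "s\<^sup>2 \<le> 1 / 25" by (simp add: power2_eq_square)
  qed (use s in simp)
  have Gpos: "0 < G" using G(1) s2 by linarith
  have V: "moment q 2 \<le> 7.395 / s ^ 4" and k4: "moment q 4 \<le> 157.5 / s ^ 6"
    using moment_bounds[OF s(1)] s by (simp_all add: q_def)
  have mpos: "0 \<le> moment q r" for r unfolding moment_def
    using q log_coeff_bounds by (intro suminf_nonneg summable_moment) auto
  have cont: "continuous_on S h" for S
    unfolding h_def by (intro continuous_intros continuous_on_pp_gf_circle q)
  have ge_neg: "- (E * g) \<le> h t" if "- decay q t \<le> ln E" "0 < E" "1 - cos t \<le> g" for E g t
  proof -
    have "exp (- decay q t) \<le> E" using that by (metis exp_le_cancel_iff exp_ln)
    hence "exp (- decay q t) * (1 - cos t) \<le> E * g" using that by (intro mult_mono) auto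
    moreover have "- 1 * (exp (- decay q t) * (1 - cos t)) \<le> cos (phase q n t) * (exp (- decay q t) * (1 - cos t))"
      by (intro mult_right_mono) auto
    ultimately show ?thesis by (simp add: h_def mult_ac)
  qed
  have ord: "0 \<le> 1.07 * s\<^sup>2" "1.07 * s\<^sup>2 \<le> s / 2" "s / 2 \<le> 1.1 * s" "1.1 * s \<le> pi"
  proof -
    have "1.07 * s\<^sup>2 = (1.07 * s) * s" by (simp add: power2_eq_square)
    also have "\<dots> \<le> (1 / 2) * s" using s by (intro mult_right_mono) auto
    finally show "1.07 * s\<^sup>2 \<le> s / 2" by simp
    show "1.1 * s \<le> pi" using s pi_gt3 by simp
  qed (use s in auto)

  have I1: "0.4995 * s ^ 6 * 0.0387 \<le> integral {0..1.07 * s\<^sup>2} h"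
  proof -
    define F :: "real \<Rightarrow> real" where "F = (\<lambda>y. - exp (- (3.7 * y\<^sup>2)) * (0.0387 + 0.1435 * y ^ 2 - 0.2344 * y ^ 4 - 0.0915 * y ^ 6 - 0.044 * y ^ 8))"
    define F' :: "real \<Rightarrow> real" where "F' = (\<lambda>y. exp (- (3.7 * y\<^sup>2)) * (2 * y * (- 0.00031 + 0.99975 * y ^ 2 - 0.59278 * y ^ 4 - 0.16255 * y ^ 6 - 0.1628 * y ^ 8)))"
    have "0.4995 * s ^ 6 * F (1.07 * s\<^sup>2 / s\<^sup>2) - 0.4995 * s ^ 6 * F (0 / s\<^sup>2) \<le> integral {0..1.07 * s\<^sup>2} h"
    proof (rule integral_ge_antiderivative[OF ord(1) cont])
      show "((\<lambda>t. 0.4995 * s ^ 6 * F (t / s\<^sup>2)) has_real_derivative (0.4995 * s ^ 6 / s\<^sup>2 * F' (t / s\<^sup>2))) (at t)" for t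
        by (rule DERIV_rescale) (use s core_antiderivative in \<open>auto simp: F_def F'_def\<close>)
      fix t assume t: "t \<in> {0..1.07 * s\<^sup>2}"
      define y where "y = t / s\<^sup>2"
      have y: "0 \<le> y" "y \<le> 1.07" using t s by (auto simp: y_def divide_simps)
      have ty: "t = s\<^sup>2 * y" using s by (simp add: y_def)
      \<comment> \<open>3.7 rounds up half of 7.395.\<close>
      have A: "exp (- (3.7 * y\<^sup>2)) \<le> exp (- decay q t)"
      proof -
        have "decay q t \<le> moment q 2 * t\<^sup>2 / 2" by (rule decay_le) (use q in auto)
        also have "\<dots> \<le> 7.395 / s ^ 4 * t\<^sup>2 / 2" using V by (intro divide_right_mono mult_right_mono) auto
        also have "\<dots> = 3.6975 * y\<^sup>2" using s by (simp add: ty power_mult_distrib power_mult[symmetric])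
        also have "\<dots> \<le> 3.7 * y\<^sup>2" by (intro mult_right_mono) auto
        finally show ?thesis by simp
      qed
      \<comment> \<open>\<open>7.395 * 157.5 / 36 = 32.353125\<close>, which
        \<open>s ^ 2 \<le> 1 / 25\<close> brings below 1.3.\<close>
      have B: "1 - 0.65 * y ^ 6 \<le> cos (phase q n t)"
      proof -
        have "(phase q n t)\<^sup>2 \<le> moment q 2 * moment q 4 * t ^ 6 / 36"
          using n by (intro phase_squared_le q) (simp add: q_def)
        also have "\<dots> \<le> 7.395 / s ^ 4 * (157.5 / s ^ 6) * t ^ 6 / 36"
          using V k4 mpos s t by (intro divide_right_mono mult_right_mono mult_mono) auto
        also have "\<dots> = 32.353125 * s\<^sup>2 * y ^ 6"
          using s by (simp add: ty eval_nat_numeral field_simps)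
        also have "\<dots> \<le> 1.3 * y ^ 6" using s2 by (intro mult_right_mono) auto
        finally have "(phase q n t)\<^sup>2 / 2 \<le> 0.65 * y ^ 6" by simp
        thus ?thesis using one_minus_cos_le[of "phase q n t"] by simp
      qed
      have C: "0.4995 * s ^ 4 * y\<^sup>2 \<le> 1 - cos t"
      proof -
        have "t \<le> 1.07 * s\<^sup>2" using t by simp
        hence t1: "t \<le> 0.05" using s2 by simp
        have t0: "0 \<le> t" using t by simp
        have "t\<^sup>2 \<le> 0.05\<^sup>2" using t1 t0 by (intro power_mono) auto
        hence "t\<^sup>2 / 2 * 0.999 \<le> t\<^sup>2 / 2 * (1 - t\<^sup>2 / 12)" by (intro mult_left_mono) (auto simp: power2_eq_square)
        also have "\<dots> \<le> 1 - cos t" using t0 t1 by (intro one_minus_cos_ge) auto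
        finally show ?thesis by (simp add: ty power_mult_distrib power_mult[symmetric])
      qed
      have y6: "0 \<le> 1 - 0.65 * y ^ 6"
      proof -
        have "y ^ 6 \<le> 1.07 ^ 6" using y by (intro power_mono) auto
        also have "(1.07 :: real) ^ 6 \<le> 1.51" by (simp add: eval_nat_numeral)
        finally show ?thesis by simp
      qed
      have "0.4995 * s ^ 6 / s\<^sup>2 = 0.4995 * s ^ 4" using s by (simp add: eval_nat_numeral)
      hence "0.4995 * s ^ 6 / s\<^sup>2 * F' (t / s\<^sup>2) = 0.4995 * s ^ 4 * F' y"
        by (simp only: y_def)
      also have "\<dots> \<le> 0.4995 * s ^ 4 * (exp (- (3.7 * y\<^sup>2)) * (y\<^sup>2 * (1 - 0.65 * y ^ 6)))"
        unfolding F'_def using core_derivative_le[OF y(1)] s by (intro mult_left_mono) auto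
      also have "\<dots> = exp (- (3.7 * y\<^sup>2)) * (1 - 0.65 * y ^ 6) * (0.4995 * s ^ 4 * y\<^sup>2)" by simp
      also have "\<dots> \<le> exp (- decay q t) * cos (phase q n t) * (1 - cos t)"
        using A B C y6 s by (intro mult_mono mult_nonneg_nonneg) auto
      finally show "0.4995 * s ^ 6 / s\<^sup>2 * F' (t / s\<^sup>2) \<le> h t" by (simp add: h_def)
    qed
    \<comment> \<open>The polynomial in \<open>F\<close> is negative at 1.07, so the upper endpoint
      only helps and the value at 0 alone counts.\<close>
    moreover have "0 \<le> F 1.07" by (simp add: F_def eval_nat_numeral)
    hence "0 \<le> 0.4995 * s ^ 6 * F 1.07" using s by simp
    moreover have "F 0 = - 0.0387" by (simp add: F_def)
    ultimately show ?thesis using s by simp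
  qed

  have I2: "- (0.0147 * s ^ 6) \<le> integral {1.07 * s\<^sup>2..s / 2} h"
  proof -
    define F :: "real \<Rightarrow> real" where "F = (\<lambda>y. exp (- (2.06 * y\<^sup>2)) * (0.0934 * y ^ 2 + 0.2032))"
    define F' :: "real \<Rightarrow> real" where "F' = (\<lambda>y. - (exp (- (2.06 * y\<^sup>2)) * (y * (0.384808 * y ^ 2 + 0.650384))))"
    have "s ^ 6 / 2 * F (s / 2 / s\<^sup>2) - s ^ 6 / 2 * F (1.07 * s\<^sup>2 / s\<^sup>2) \<le> integral {1.07 * s\<^sup>2..s / 2} h"
    proof (rule integral_ge_antiderivative[OF ord(2) cont])
      show "((\<lambda>t. s ^ 6 / 2 * F (t / s\<^sup>2)) has_real_derivative (s ^ 6 / 2 / s\<^sup>2 * F' (t / s\<^sup>2))) (at t)" for t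
        by (rule DERIV_rescale) (use s tail_antiderivative in \<open>auto simp: F_def F'_def\<close>)
      fix t assume t: "t \<in> {1.07 * s\<^sup>2..s / 2}"
      define y where "y = t / s\<^sup>2"
      have t0: "0 \<le> t" using t order_trans[OF ord(1)] by (simp del: zero_le_mult_iff)
      have y: "0 \<le> y" using t0 by (simp add: y_def)
      have ty: "t = s\<^sup>2 * y" using s by (simp add: y_def)
      have t1: "t \<le> 0.1" using t s by simp
      have tsq: "t\<^sup>2 \<le> 0.01" using power_mono[OF t1 t0, of 2] by (simp add: power2_eq_square)
      have g_le: "1 - cos t \<le> t\<^sup>2 / 2" by (rule one_minus_cos_le)
      have g_ge: "t\<^sup>2 / 2 * 0.999 \<le> 1 - cos t"
      proof -
        have "t\<^sup>2 / 2 * 0.999 \<le> t\<^sup>2 / 2 * (1 - t\<^sup>2 / 12)" using tsq by (intro mult_left_mono) auto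
        also have "\<dots> \<le> 1 - cos t" using t0 t1 by (intro one_minus_cos_ge) auto
        finally show ?thesis .
      qed
      have "t\<^sup>2 \<le> (s / 2)\<^sup>2" using t t0 by (intro power_mono) auto
      hence "4 * (1 - cos t) \<le> G" using g_le G(1) by (simp add: power_divide)
      hence dec: "2.08 * (1 - cos t) / (2 * G\<^sup>2) \<le> decay q t"
        unfolding G_def by (rule decay_ge_cases(1)[OF q])
      \<comment> \<open>2.06 lies below \<open>2.08 * 0.999 / 1.0037 ^ 2\<close>.\<close>
      have "2.06 * y\<^sup>2 = 2.06 * t\<^sup>2 / s ^ 4"
        using s by (simp add: ty power_mult_distrib power_mult[symmetric])
      also have "\<dots> \<le> 2.08 * (t\<^sup>2 / 2 * 0.999) / (2 * (s\<^sup>2 / 2 * 1.0037)\<^sup>2)"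
        using s by (simp add: power_mult_distrib power_divide power_mult[symmetric] divide_simps)
      also have "\<dots> \<le> 2.08 * (1 - cos t) / (2 * G\<^sup>2)"
        using g_ge G Gpos by (intro frac_le mult_left_mono power_mono) auto
      also note dec
      finally have "- decay q t \<le> ln (exp (- (2.06 * y\<^sup>2)))" by simp
      from ge_neg[OF this exp_gt_zero g_le]
      have "- (exp (- (2.06 * y\<^sup>2)) * (t\<^sup>2 / 2)) \<le> h t" .
      moreover have "t\<^sup>2 / 2 = s ^ 4 / 2 * y\<^sup>2" by (simp add: ty power_mult_distrib power_mult[symmetric])
      moreover have "s ^ 6 / 2 / s\<^sup>2 * F' (t / s\<^sup>2) = s ^ 4 / 2 * F' y"
        using s by (simp add: y_def eval_nat_numeral)
      moreover have "s ^ 4 / 2 * F' y \<le> s ^ 4 / 2 * - (exp (- (2.06 * y\<^sup>2)) * y\<^sup>2)"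
        unfolding F'_def using tail_derivative_ge[OF y] s by (intro mult_left_mono) auto
      ultimately show "s ^ 6 / 2 / s\<^sup>2 * F' (t / s\<^sup>2) \<le> h t" by (simp add: mult_ac)
    qed
    moreover have "F 1.07 \<le> 0.0294"
    proof -
      \<comment> \<open>\<open>4 * 0.5896\<close> lies just below \<open>2.06 * 1.07 ^ 2\<close>;
        the fourth power lets six Taylor terms suffice.\<close>
      have "(10.55 :: real) \<le> (\<Sum>m<6. 0.5896 ^ m / fact m) ^ 4"
        by (simp add: lessThan_nat_numeral lessThan_Suc fact_numeral eval_nat_numeral)
      also have "\<dots> \<le> exp 0.5896 ^ 4"
        by (intro power_mono exp_ge_Taylor sum_nonneg) auto
      also have "\<dots> = exp (2.3584 :: real)" by (simp add: exp_of_nat_mult[symmetric])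
      also have "\<dots> \<le> exp (2.06 * 1.07\<^sup>2)" by (simp add: power2_eq_square)
      finally have "exp (- (2.06 * 1.07\<^sup>2)) \<le> 1 / (10.55 :: real)"
        by (simp add: exp_minus field_simps)
      moreover have "F 1.07 = exp (- (2.06 * 1.07\<^sup>2)) * (0.0934 * 1.07 ^ 2 + 0.2032)"
        by (simp add: F_def)
      moreover have "exp (- (2.06 * 1.07\<^sup>2)) * (0.0934 * 1.07 ^ 2 + 0.2032) \<le> 1 / (10.55 :: real) * (0.0934 * 1.07 ^ 2 + 0.2032)"
        using calculation(1) by (intro mult_right_mono) auto
      moreover have "1 / (10.55 :: real) * (0.0934 * 1.07 ^ 2 + 0.2032) \<le> 0.0294"
        by (simp add: power2_eq_square)
      ultimately show ?thesis by simp
    qed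
    hence "s ^ 6 / 2 * F 1.07 \<le> s ^ 6 / 2 * 0.0294" using s by (intro mult_left_mono) auto
    moreover have "s ^ 6 / 2 * 0.0294 = 0.0147 * s ^ 6" "1.07 * s\<^sup>2 / s\<^sup>2 = 1.07" using s by simp_all
    moreover have "0 \<le> s ^ 6 / 2 * F (s / 2 / s\<^sup>2)" using s by (simp add: F_def)
    ultimately show ?thesis by (simp only:)
  qed

  \<comment> \<open>\<open>E\<close> bounds the modulus from \<open>s / 2\<close> on, since 0.488
    lies below \<open>0.49 / 1.0037\<close>; from \<open>1.1 * s\<close> on the decay is at least
    twice as large, so \<open>E ^ 2\<close> works.\<close>
  define E where "E = exp (- (0.488 / s\<^sup>2))"
  have E: "0 < E" "E \<le> s ^ 4 / 40"
  proof -
    have "25 \<le> 1 / s\<^sup>2" using s2 by (simp add: field_simps)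
    from exp_ge_40_squares[OF this] have "40 / s ^ 4 \<le> exp (0.488 / s\<^sup>2)"
      by (simp add: power_divide power_mult[symmetric])
    thus "E \<le> s ^ 4 / 40" using s by (simp add: E_def exp_minus field_simps)
  qed (simp add: E_def)

  have gmono: "1 - cos a \<le> 1 - cos t" if "0 \<le> a" "a \<le> t" "t \<le> pi" for a t :: real
    using cos_monotone_0_pi_le[OF that] by simp

  have I3: "- (0.363 * s ^ 3 * E) \<le> integral {s / 2..1.1 * s} h"
  proof -
    have "- (E * (0.605 * s\<^sup>2)) * (1.1 * s) - - (E * (0.605 * s\<^sup>2)) * (s / 2) \<le> integral {s / 2..1.1 * s} h"
    proof (rule integral_ge_antiderivative[OF ord(3) cont])
      show "((\<lambda>t. - (E * (0.605 * s\<^sup>2)) * t) has_real_derivative - (E * (0.605 * s\<^sup>2))) (at t)" for t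
        by (rule derivative_eq_intros refl)+ simp
      fix t assume t: "t \<in> {s / 2..1.1 * s}"
      \<comment> \<open>At \<open>t = s / 2\<close> the ratio \<open>g / G\<close> is close to
        \<open>1 / 4\<close>; 0.23 leaves room for the higher-order terms.\<close>
      have "0.23 * G \<le> 1 - cos (s / 2)"
      proof -
        have "0.23 * G \<le> 0.23 * (s\<^sup>2 / 2 * 1.0037)" using G(2) by (intro mult_left_mono) auto
        also have "\<dots> \<le> (s / 2)\<^sup>2 / 2 * (1 - (s / 2)\<^sup>2 / 12)"
        proof -
          have "s\<^sup>2 * 0.1154255 \<le> s\<^sup>2 * (1 / 8 * (1 - s\<^sup>2 / 48))" using s2 by (intro mult_left_mono) auto
          thus ?thesis by (simp add: power_divide)
        qed
        also have "\<dots> \<le> 1 - cos (s / 2)" using s by (intro one_minus_cos_ge) auto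
        finally show ?thesis .
      qed
      also have "\<dots> \<le> 1 - cos t" using t ord s by (intro gmono) auto
      finally have "0.49 / (2 * G) \<le> decay q t"
        unfolding G_def by (rule decay_ge_cases(2)[OF q])
      moreover have "0.488 / s\<^sup>2 \<le> 0.49 / (2 * G)"
        using G(2) Gpos s2 by (simp add: field_simps)
      ultimately have "- decay q t \<le> ln E" by (simp add: E_def)
      moreover have "1 - cos t \<le> 0.605 * s\<^sup>2"
      proof -
        have "t\<^sup>2 \<le> (1.1 * s)\<^sup>2" using t s by (intro power_mono) auto
        thus ?thesis using one_minus_cos_le[of t] by (simp add: power_mult_distrib power2_eq_square)
      qed
      ultimately show "- (E * (0.605 * s\<^sup>2)) \<le> h t" using E by (intro ge_neg)
    qed
    thus ?thesis by (simp add: eval_nat_numeral field_simps)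
  qed

  have I4: "- (6.4 * E\<^sup>2) \<le> integral {1.1 * s..pi} h"
  proof -
    have "- (E\<^sup>2 * 2) * pi - - (E\<^sup>2 * 2) * (1.1 * s) \<le> integral {1.1 * s..pi} h"
    proof (rule integral_ge_antiderivative[OF ord(4) cont])
      show "((\<lambda>t. - (E\<^sup>2 * 2) * t) has_real_derivative - (E\<^sup>2 * 2)) (at t)" for t
        by (rule derivative_eq_intros refl)+ simp
      fix t assume t: "t \<in> {1.1 * s..pi}"
      have "G \<le> 1 - cos (1.1 * s)"
      proof -
        have "G \<le> (1.1 * s)\<^sup>2 / 2 * (1 - (1.1 * s)\<^sup>2 / 12)"
        proof -
          have "G \<le> s\<^sup>2 * 0.50185" using G(2) by simp
          also have "\<dots> \<le> s\<^sup>2 * (0.605 * (1 - 1.21 * s\<^sup>2 / 12))" using s2 by (intro mult_left_mono) auto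
          also have "\<dots> = (1.1 * s)\<^sup>2 / 2 * (1 - (1.1 * s)\<^sup>2 / 12)"
            by (simp add: power_mult_distrib) (simp add: power2_eq_square field_simps)
          finally show ?thesis .
        qed
        also have "\<dots> \<le> 1 - cos (1.1 * s)" using s by (intro one_minus_cos_ge) auto
        finally show ?thesis .
      qed
      also have "\<dots> \<le> 1 - cos t" using t s by (intro gmono) auto
      finally have "1 / (2 * G) \<le> decay q t"
        unfolding G_def by (rule decay_ge_cases(3)[OF q])
      moreover have "2 * (0.488 / s\<^sup>2) \<le> 1 / (2 * G)"
        using G(2) Gpos s2 by (simp add: field_simps)
      ultimately have "- decay q t \<le> ln (E\<^sup>2)" by (simp add: E_def exp_of_nat_mult[symmetric] flip: exp_of_nat_mult)
      thus "- (E\<^sup>2 * 2) \<le> h t" using E cos_ge_minus_one[of t] by (intro ge_neg) auto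
    qed
    moreover have "- (6.4 * E\<^sup>2) \<le> - (E\<^sup>2 * 2) * pi - - (E\<^sup>2 * 2) * (1.1 * s)"
    proof -
      have "E\<^sup>2 * pi \<le> E\<^sup>2 * 3.2" using pi_approx by (intro mult_left_mono) auto
      moreover have "0 \<le> E\<^sup>2 * s" using s by simp
      ultimately show ?thesis by (simp add: algebra_simps)
    qed
    ultimately show ?thesis by (rule order_trans[rotated])
  qed

  have split: "integral {a..c} h = integral {a..b} h + integral {b..c} h" if "a \<le> b" "b \<le> c" for a b c
    using that by (intro Henstock_Kurzweil_Integration.integral_combine[symmetric] integrable_continuous_real cont)
  have "integral {0..pi} h = integral {0..1.07 * s\<^sup>2} h + (integral {1.07 * s\<^sup>2..s / 2} h
      + (integral {s / 2..1.1 * s} h + integral {1.1 * s..pi} h))"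
    using split[OF ord(1) order_trans[OF ord(2) order_trans[OF ord(3,4)]]]
      split[OF ord(2) order_trans[OF ord(3,4)]] split[OF ord(3,4)] by linarith
  moreover have "0.363 * s ^ 3 * E \<le> 0.001815 * s ^ 6"
  proof -
    have "0.363 * s ^ 3 * E \<le> 0.363 * s ^ 3 * (s ^ 4 / 40)" using E s by (intro mult_left_mono) auto
    also have "\<dots> = 0.009075 * s ^ 6 * s" by (simp add: eval_nat_numeral)
    also have "\<dots> \<le> 0.009075 * s ^ 6 * (1 / 5)" using s by (intro mult_left_mono) auto
    finally show ?thesis using s by simp
  qed
  moreover have "6.4 * E\<^sup>2 \<le> 0.00016 * s ^ 6"
  proof -
    have "E\<^sup>2 \<le> (s ^ 4 / 40)\<^sup>2" using E by (intro power_mono) auto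
    also have "\<dots> = s ^ 6 * s\<^sup>2 / 1600" by (simp add: eval_nat_numeral)
    also have "\<dots> \<le> s ^ 6 * (1 / 25) / 1600" using s2 s by (intro divide_right_mono mult_left_mono) auto
    finally show ?thesis by simp
  qed
  moreover have "0 < s ^ 6" using s by simp
  \<comment> \<open>The budget in units of \<open>s ^ 6\<close>: the core gives more than 0.0193,
    the other pieces lose at most 0.016675.\<close>
  moreover have "0 < a" if "a = i1 + (i2 + (i3 + i4))" "0.4995 * S * 0.0387 \<le> i1" "- (0.0147 * S) \<le> i2"
    "- x \<le> i3" "- y \<le> i4" "x \<le> 0.001815 * S" "y \<le> 0.00016 * S" "0 < S"
    for a i1 i2 i3 i4 x y S :: real
    using that by simp
  ultimately have "0 < integral {0..pi} h" using I1 I2 I3 I4 by meson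
  thus ?thesis by (simp add: h_def[abs_def] q_def)
qed

lemma pp_log_concave_from_303:
  assumes "303 \<le> n"
  shows "pp (n - 1) * pp (n + 1) < (pp n)\<^sup>2"
proof -
  obtain s where s: "0 < s" "s \<le> 1 / 5" "moment (exp (- s)) 1 = real n"
    using exists_saddle_point[OF assms] .
  show ?thesis
    by (rule log_concave_of_integral_pos[where q = "exp (- s)"])
      (use s assms integral_pos[OF s] in auto)
qed

lemma pp_log_concave_iff:
  assumes "0 < n"
  shows "pp (n - 1) * pp (n + 1) < (pp n)\<^sup>2 \<longleftrightarrow> \<not> (n < 12 \<and> odd n)"
  using assms pp_log_concave_upto_303 pp_log_concave_from_303 by (cases "n \<le> 303") auto

theorem theorem1p2:
  shows "(\<forall>n::nat. 12 \<le> n \<and> n \<le> 10 ^ 5 \<longrightarrow> pp n ^ 2 > pp (n - 1) * pp (n + 1)) \<and>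
         (\<forall>n::nat. n > 0 \<and> even n \<longrightarrow> pp n ^ 2 > pp (n - 1) * pp (n + 1)) \<and>
         (\<forall>n::nat. n > 0 \<and> odd n \<and> n < 12 \<longrightarrow> \<not> (pp n ^ 2 > pp (n - 1) * pp (n + 1))) \<and>
         (\<exists>N::nat. \<forall>n>N. pp n ^ 2 > pp (n - 1) * pp (n + 1))"
proof (intro conjI allI impI exI[of _ 12])
  show "pp n ^ 2 > pp (n - 1) * pp (n + 1)" if "12 \<le> n \<and> n \<le> 10 ^ 5" for n :: nat
    using that pp_log_concave_iff[of n] by simp
  show "pp n ^ 2 > pp (n - 1) * pp (n + 1)" if "n > 0 \<and> even n" for n :: nat
    using that pp_log_concave_iff[of n] by simp
  show "\<not> (pp n ^ 2 > pp (n - 1) * pp (n + 1))" if "n > 0 \<and> odd n \<and> n < 12" for n :: nat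
    using that pp_log_concave_iff[of n] by simp
  show "pp n ^ 2 > pp (n - 1) * pp (n + 1)" if "12 < n" for n :: nat
    using that pp_log_concave_iff[of n] by simp
qed

end
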